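(* Given a real $m \times n$ matrix $A$, the following statements are equivalent. (i) $A$ is totally positive. (ii) For all $0 \neq x \in \mathbb{R}^n$, $S^+(Ax) \leq S^-(x)$. If moreover equality occurs and $Ax \neq 0$, then the first (respectively, last) component of $Ax$ (if zero, then the unique sign required to determine $S^+(Ax)$) has the same sign as the first (respectively, last) nonzero component of $x$. (iii) For every $r \in\{1,\ldots,\min\{m,n\}\}$ and every contiguous $r\times r$ submatrix $A_r$ of $A$, defining the vector $$x^{A_r}:= (A^{11}_r,-A^{12}_r,\ldots ,(-1)^{r-1}A^{1 r}_r)^T\in\mathbb{R}^r,$$ one has $S^+(A_rx^{A_r}) \leq S^-(x^{A_r})$. If equality holds here, then the first (respectively, last) component of $A_rx^{A_r}$ (if zero, the unique sign required to determine $S^+(A_rx^{A_r})$) has the same sign as the first (respectively, last) nonzero component of $x^{A_r}$.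
   Context: A real matrix is totally positive if all its minors (of every order) are positive. A contiguous submatrix is one whose row index set and column index set are each sets of consecutive integers. For an $r\times r$ matrix $A_r$, $A_r^{ij}$ denotes the determinant of the submatrix of $A_r$ obtained by deleting row $i$ and column $j$; if $r=1$, $A_1^{11}:=1$. For $x\in\mathbb{R}^p$, $S^-(x)$ is the number of sign changes in the sequence of coordinates of $x$ after deleting all zero entries, and $S^+(x)$ is the maximum possible number of sign changes in the sequence obtained by assigning each zero entry of $x$ an arbitrary value $\pm1$. For the zero vector $0\in\mathbb{R}^p$ one sets $S^+(0):=p$ and $S^-(0):=0$. The phrase "if zero, the unique sign required to determine $S^+(v)$" for the first (last) component of a vector $v$ means: if this component is $0$, its sign is taken to be the sign it must receive in an assignment of $\pm1$ to the zero entries of $v$ attaining the maximum $S^+(v)$. *)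

theory Defs
  imports
    Complex_Main
    "Jordan_Normal_Form.Determinant"
    "Jordan_Normal_Form.DL_Submatrix"
begin

text \<open>The determinant of the \<open>0 \<times> 0\<close> matrix is \<open>1\<close>, so the empty minor is excluded.\<close>

definition totally_positive :: "real mat \<Rightarrow> bool" where
  "totally_positive A \<longleftrightarrow>
     (\<forall>I J. I \<subseteq> {..<dim_row A} \<longrightarrow> J \<subseteq> {..<dim_col A} \<longrightarrow> I \<noteq> {} \<longrightarrow> card I = card J \<longrightarrow>
        det (submatrix A I J) > 0)"

definition contiguous_submatrix :: "nat \<Rightarrow> real mat \<Rightarrow> real mat \<Rightarrow> bool" where
  "contiguous_submatrix r A B \<longleftrightarrow>
     (\<exists>i j. i + r \<le> dim_row A \<and> j + r \<le> dim_col A \<and>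
        B = submatrix A {i..<i + r} {j..<j + r})"

definition sign_changes :: "real list \<Rightarrow> nat" where
  "sign_changes xs = card {i. Suc i < length xs \<and> xs ! i * xs ! Suc i < 0}"

definition nonzero_entries :: "real vec \<Rightarrow> real list" where
  "nonzero_entries v = filter (\<lambda>a. a \<noteq> 0) (list_of_vec v)"

definition S_minus :: "real vec \<Rightarrow> nat" where
  "S_minus v = sign_changes (nonzero_entries v)"

definition zero_assignments :: "real vec \<Rightarrow> real vec set" where
  "zero_assignments v =
     {w \<in> carrier_vec (dim_vec v).
        \<forall>i < dim_vec v. if v $ i = 0 then w $ i \<in> {-1, 1} else w $ i = v $ i}"

text \<open>By convention the zero vector of length \<open>p\<close> has \<open>S_plus\<close> equal to \<open>p\<close>; the
  maximum over assignments would only be \<open>p - 1\<close>.\<close>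

definition S_plus :: "real vec \<Rightarrow> nat" where
  "S_plus v =
     (if v = 0\<^sub>v (dim_vec v) then dim_vec v
      else Max ((\<lambda>w. sign_changes (list_of_vec w)) ` zero_assignments v))"

text \<open>If \<open>v\<close> is nonzero, all maximising assignments agree in the first and in the last
  component, because a leading (or trailing) block of zeros has to be filled alternatingly. The
  description below is meaningful only there: for the zero vector no assignment attains
  \<open>S_plus v\<close>, and at interior zeros the sign need not be unique.\<close>

definition S_plus_sign :: "real vec \<Rightarrow> nat \<Rightarrow> real" where
  "S_plus_sign v i =
     (if v $ i \<noteq> 0 then sgn (v $ i)
      else (THE s. s \<in> {-1, 1} \<and>
              (\<forall>w \<in> zero_assignments v. sign_changes (list_of_vec w) = S_plus v \<longrightarrow> w $ i = s)))"

definition end_signs_agree :: "real vec \<Rightarrow> real vec \<Rightarrow> bool" where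
  "end_signs_agree y x \<longleftrightarrow>
     S_plus_sign y 0 = sgn (hd (nonzero_entries x)) \<and>
     S_plus_sign y (dim_vec y - 1) = sgn (last (nonzero_entries x))"

text \<open>Rows and columns are numbered from \<open>0\<close>: in one-based notation, entry \<open>j\<close> is
  \<open>(-1)^(k-1) B^(1 k)\<close> with \<open>k = j + 1\<close>. For a \<open>1 \<times> 1\<close> matrix the deleted matrix is
  \<open>0 \<times> 0\<close>, with determinant \<open>1\<close>.\<close>

definition test_vec :: "real mat \<Rightarrow> real vec" where
  "test_vec B = vec (dim_col B) (\<lambda>j. (-1) ^ j * det (mat_delete B 0 j))"

end

theory Submission
  imports Defs
begin

text \<open>
  (i) implies (ii): group the coordinates of \<open>x\<close> into its \<open>k + 1\<close> maximal blocks of constant sign and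
  sum the columns of \<open>A\<close> over each block, with weights \<open>\<bar>x\<^sub>j\<bar>\<close>. All minors of the resulting
  \<open>m \<times> (k + 1)\<close> matrix are positive, and \<open>A x\<close> is its product with an alternating sign vector.
  A choice of \<open>k + 2\<close> weakly alternating entries of \<open>A x\<close> contradicts the linear relation between
  \<open>k + 2\<close> rows, and Cramer's rule on \<open>k + 1\<close> weakly alternating entries yields the end signs.

  (ii) or (iii) implies (i): a contiguous \<open>r \<times> r\<close> block maps its test vector to
  \<open>(det, 0, \<dots>, 0)\<close>, for which \<open>S_plus\<close> is at least \<open>r - 1\<close>, while \<open>S_minus\<close> of the test vector is at
  most \<open>r - 1\<close>. So equality holds, and the end sign condition makes the determinant have the sign of
  the first entry of the test vector, a contiguous minor of order \<open>r - 1\<close>. By induction all contiguous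
  minors are positive, and Fekete's criterion gives total positivity. Under (ii) one pads the test
  vector with zeros; the block then occupies \<open>r\<close> consecutive entries of \<open>A x\<close>, and any further sign
  change outside it would make \<open>S_plus\<close> too large.
\<close>

section \<open>Minors\<close>

text \<open>The entries come from a function on all pairs of indices and \<open>f\<close>,
  \<open>g\<close> are arbitrary maps, so rows and columns can be repeated, shifted or dropped by
  composing maps.\<close>

definition minor :: "(nat \<Rightarrow> nat \<Rightarrow> real) \<Rightarrow> nat \<Rightarrow> (nat \<Rightarrow> nat) \<Rightarrow> (nat \<Rightarrow> nat) \<Rightarrow> real" where
  "minor c r f g = det (mat r r (\<lambda>(i,j). c (f i) (g j)))"

lemma minor_cong:
  assumes "\<And>i j. i < r \<Longrightarrow> j < r \<Longrightarrow> c (f i) (g j) = c' (f' i) (g' j)"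
  shows "minor c r f g = minor c' r f' g'"
  unfolding minor_def by (rule arg_cong[where f = det]) (auto intro!: eq_matI assms)

lemma minor_0 [simp]: "minor c 0 f g = 1"
  by (simp add: minor_def)

lemma minor_swap: "minor c r f g = minor (\<lambda>i j. c j i) r g f"
proof -
  have "mat r r (\<lambda>(i,j). c (f j) (g i)) = transpose_mat (mat r r (\<lambda>(i,j). c (f i) (g j)))"
    by (auto intro!: eq_matI)
  then show ?thesis
    by (simp add: minor_def det_transpose[where n = r])
qed

lemma minor_laplace:
  "minor c (Suc d) f g =
     (\<Sum>i<Suc d. (-1)^i * c (f i) (g 0) * minor c d (f \<circ> insert_index i) (g \<circ> Suc))"
proof -
  let ?M = "mat (Suc d) (Suc d) (\<lambda>(i,j). c (f i) (g j))"
  have "mat_delete ?M i 0 = mat d d (\<lambda>(i',j'). c ((f \<circ> insert_index i) i') ((g \<circ> Suc) j'))"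
    if "i < Suc d" for i
    using that by (auto simp: mat_delete_def insert_index_def intro!: eq_matI)
  then show ?thesis
    unfolding minor_def
    by (subst laplace_expansion_column[of _ "Suc d" 0])
       (auto simp: cofactor_def intro!: sum.cong)
qed

text \<open>Laplace expansion along column 0 of the minor with column \<open>g q\<close> put in
  front of the columns \<open>g\<close>: that column then occurs twice, so the determinant is 0.
  Hence maximal minors with alternating signs form a left null vector of \<open>d + 1\<close> rows
  in \<open>d\<close> columns.\<close>

lemma alternating_minors_left_null:
  assumes "q < d"
  shows "(\<Sum>i<Suc d. (-1)^i * c (f i) (g q) * minor c d (f \<circ> insert_index i) g) = 0"
proof -
  let ?g = "case_nat (g q) g"
  have "minor c (Suc d) f ?g = 0"
    unfolding minor_def
    by (rule det_identical_columns[of _ "Suc d" 0 "Suc q"]) (use assms in \<open>auto intro!: eq_vecI\<close>)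
  moreover have "?g \<circ> Suc = g" by auto
  ultimately show ?thesis using minor_laplace[of c d f ?g] by simp
qed

text \<open>The transposed submatrix is nonsingular and the equations put \<open>v\<close> in its
  kernel.\<close>

lemma minor_right_null:
  assumes "minor c d f g \<noteq> 0"
    and "\<And>q. q < d \<Longrightarrow> (\<Sum>i<d. c (f i) (g q) * v i) = 0"
    and "p < d"
  shows "v p = 0"
proof -
  let ?M = "mat d d (\<lambda>(q,i). c (f i) (g q))"
  have "det ?M \<noteq> 0"
    using assms(1) minor_swap[of c d f g] by (simp add: minor_def)
  moreover have "?M *\<^sub>v vec d v = 0\<^sub>v d"
    using assms(2) by (auto intro!: eq_vecI simp: scalar_prod_def atLeast0LessThan)
  ultimately have "vec d v = 0\<^sub>v d"
    using det_0_iff_vec_prod_zero_field[of ?M d] by (metis mat_carrier vec_carrier)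
  then show ?thesis using \<open>p < d\<close> by (metis index_vec index_zero_vec(1))
qed

section \<open>Strictly increasing index sequences\<close>

text \<open>An index set of size \<open>r\<close> is encoded by its increasing enumeration, so that
  selecting from a selection is composition. Values of \<open>f\<close> from \<open>r\<close> on are
  unconstrained, and a shorter sequence keeps the same \<open>f\<close>.\<close>

definition index_seq :: "nat \<Rightarrow> nat \<Rightarrow> (nat \<Rightarrow> nat) \<Rightarrow> bool" where
  "index_seq r m f \<longleftrightarrow> (\<forall>i j. i < j \<longrightarrow> j < r \<longrightarrow> f i < f j) \<and> (\<forall>i<r. f i < m)"

lemma index_seq_comp:
  assumes "index_seq r m f" "index_seq s r g"
  shows "index_seq s m (f \<circ> g)"
  using assms unfolding index_seq_def by auto

lemma index_seq_inj_on: "index_seq r m f \<Longrightarrow> inj_on f {..<r}"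
  unfolding index_seq_def inj_on_def by (metis lessThan_iff less_irrefl linorder_neqE_nat)

lemma index_seq_insert_index: "index_seq r (Suc r) (insert_index i)"
  by (auto simp: index_seq_def insert_index_def)

lemma index_seq_Suc: "index_seq r (Suc r) Suc"
  by (auto simp: index_seq_def)

lemma index_seq_shift: "i + r \<le> m \<Longrightarrow> index_seq r m ((+) i)"
  by (auto simp: index_seq_def)

lemma index_seq_mono: "index_seq r m f \<Longrightarrow> s \<le> r \<Longrightarrow> index_seq s m f"
  by (auto simp: index_seq_def)

lemma index_seq_widen: "index_seq r m f \<Longrightarrow> index_seq r (Suc m) f"
  by (auto simp: index_seq_def intro: less_SucI)

lemma index_seq_stepI:
  assumes "\<And>i. Suc i < r \<Longrightarrow> f i < f (Suc i)" "\<And>i. i < r \<Longrightarrow> f i < m"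
  shows "index_seq r m f"
proof -
  have "i < j \<longrightarrow> j < r \<longrightarrow> f i < f j" for i j
  proof (induction j)
    case (Suc j)
    show ?case
    proof (intro impI)
      assume *: "i < Suc j" "Suc j < r"
      then have "f j < f (Suc j)" using assms(1) by simp
      then show "f i < f (Suc j)" using * Suc by (cases "i = j") auto
    qed
  qed simp
  then show ?thesis using assms(2) by (auto simp: index_seq_def)
qed

section \<open>Fekete's criterion\<close>

text \<open>Among the vectors annihilating the first \<open>e\<close> columns from the left, the one built from the
  minors \<open>D\<close> of the whole matrix is a combination of the two vanishing at the first (\<open>E\<close>) and at the
  last row (\<open>F\<close>), because the space of such vectors has dimension 2. The sign patterns of the latter two
  are known.\<close>

lemma middle_minor_pos:
  assumes small: "\<And>h. index_seq e (Suc (Suc e)) h \<Longrightarrow> 0 < minor c e h (\<lambda>j. j)"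
    and first: "0 < minor c (Suc e) Suc (\<lambda>j. j)"
    and last: "0 < minor c (Suc e) (\<lambda>j. j) (\<lambda>j. j)"
    and p: "p < e"
  shows "0 < minor c (Suc e) (insert_index (Suc p)) (\<lambda>j. j)"
proof -
  define D where "D i = minor c (Suc e) (insert_index i) (\<lambda>j. j)" for i
  \<comment> \<open>\<open>E i\<close> omits row 0 and row \<open>Suc i\<close>; \<open>F i\<close>,
    for \<open>i \<le> e\<close>, omits row \<open>i\<close> and the last row
    \<open>Suc e\<close>.\<close>
  define E where "E i = minor c e (Suc \<circ> insert_index i) (\<lambda>j. j)" for i
  define F where "F i = minor c e (insert_index i) (\<lambda>j. j)" for i
  have EF: "E i > 0" "F i > 0" for i
    using small[OF index_seq_comp[OF index_seq_Suc index_seq_insert_index]]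
      small[OF index_seq_widen[OF index_seq_insert_index]]
    by (simp_all add: E_def F_def)
  have D0: "D 0 > 0"
    using first unfolding D_def by (simp add: insert_index_def)
  have DL: "D (Suc e) > 0"
    using last unfolding D_def
    by (subst minor_cong[of _ _ _ _ c "\<lambda>j. j" "\<lambda>j. j"]) auto
  \<comment> \<open>\<open>a\<close> matches \<open>D\<close> with \<open>F\<close> at row 0, where
    \<open>E\<close> contributes nothing; \<open>b\<close> matches \<open>D\<close> with
    \<open>E\<close> at row \<open>Suc e\<close>, where \<open>F\<close> contributes nothing and the
    index of \<open>E\<close> is \<open>e\<close>.\<close>
  define a where "a = D 0 / F 0"
  define b where "b = D (Suc e) / E e"
  have ab: "a > 0" "b > 0" using EF D0 DL by (auto simp: a_def b_def)
  \<comment> \<open>Up to an overall sign, this is the entry of the combined left null vector at row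
    \<open>Suc i\<close>. Since the entries at rows 0 and \<open>Suc e\<close> cancel, only
    \<open>e\<close> rows remain; their minor in the first \<open>e\<close> columns is positive, so
    \<open>v\<close> vanishes.\<close>
  define v where "v i = (-1)^i * (D (Suc i) - a * F (Suc i) - b * E i)" for i
  have "v p = 0"
  proof (rule minor_right_null[of c e Suc "\<lambda>j. j"])
    show "minor c e Suc (\<lambda>j. j) \<noteq> 0"
      using small[of Suc] by (force simp: index_seq_def)
    fix q assume q: "q < e"
    have d: "(\<Sum>i<Suc (Suc e). (-1)^i * c i q * D i) = 0"
      using alternating_minors_left_null[of q "Suc e" c "\<lambda>j. j" "\<lambda>j. j"] q
      by (simp add: D_def comp_def)
    have f: "(\<Sum>i<Suc e. (-1)^i * c i q * F i) = 0"
      using alternating_minors_left_null[of q e c "\<lambda>j. j" "\<lambda>j. j"] q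
      by (simp add: F_def comp_def)
    have e: "(\<Sum>i<Suc e. (-1)^i * c (Suc i) q * E i) = 0"
      using alternating_minors_left_null[of q e c Suc "\<lambda>j. j"] q by (simp add: E_def)
    have d': "c 0 q * D 0 - (\<Sum>i<e. (-1)^i * c (Suc i) q * D (Suc i))
        - (-1)^e * c (Suc e) q * D (Suc e) = 0"
      using d by (subst (asm) sum.lessThan_Suc_shift) (simp add: sum_negf)
    have f': "c 0 q * F 0 - (\<Sum>i<e. (-1)^i * c (Suc i) q * F (Suc i)) = 0"
      using f by (subst (asm) sum.lessThan_Suc_shift) (simp add: sum_negf)
    have e': "(\<Sum>i<e. (-1)^i * c (Suc i) q * E i) + (-1)^e * c (Suc e) q * E e = 0"
      using e by simp
    have "(\<Sum>i<e. c (Suc i) q * v i) =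
       (\<Sum>i<e. (-1)^i * c (Suc i) q * D (Suc i))
        - a * (\<Sum>i<e. (-1)^i * c (Suc i) q * F (Suc i)) - b * (\<Sum>i<e. (-1)^i * c (Suc i) q * E i)"
      by (simp add: v_def sum_distrib_left sum_subtractf[symmetric] algebra_simps)
    also have "\<dots> = (c 0 q * D 0 - (-1)^e * c (Suc e) q * D (Suc e))
        - a * (c 0 q * F 0) + b * ((-1)^e * c (Suc e) q * E e)"
      using d' f' e' by (simp add: algebra_simps eq_neg_iff_add_eq_0)
         (metis (no_types) add.commute add.left_commute mult_zero_right ring_class.ring_distribs(1))
    also have "\<dots> = 0"
      using EF[of 0] EF[of e] by (simp add: a_def b_def)
    finally show "(\<Sum>i<e. c (Suc i) q * v i) = 0" .
  qed (rule p)
  then have "D (Suc p) = a * F (Suc p) + b * E p" by (simp add: v_def)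
  then show ?thesis using ab EF by (simp add: D_def[symmetric] add_pos_pos)
qed

text \<open>Induction on the spread \<open>f e - f 0\<close>. If the rows have no gap, they are
  contiguous. Otherwise a row inserted into a gap gives \<open>e + 2\<close> rows; omitting the
  first or the last of them leaves a smaller spread, and \<open>middle_minor_pos\<close> turns
  positivity of these two minors into positivity at \<open>f\<close>.\<close>

lemma fekete:
  assumes small: "\<And>f. index_seq e m f \<Longrightarrow> 0 < minor c e f (\<lambda>j. j)"
    and contig: "\<And>i. i + Suc e \<le> m \<Longrightarrow> 0 < minor c (Suc e) ((+) i) (\<lambda>j. j)"
    and "index_seq (Suc e) m f"
  shows "0 < minor c (Suc e) f (\<lambda>j. j)"
  using assms(3)
proof (induction "f e - f 0" arbitrary: f rule: less_induct)
  case less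
  note f = less.prems
  show ?case
  proof (cases "\<exists>k<e. Suc (f k) < f (Suc k)")
    case False
    have step: "f (Suc k) = Suc (f k)" if "k < e" for k
    proof -
      have "f k < f (Suc k)" using f that by (simp add: index_seq_def)
      with False that show ?thesis by fastforce
    qed
    have eq: "k \<le> e \<Longrightarrow> f k = f 0 + k" for k
      by (induction k) (auto simp: step)
    have "f e < m" using f by (simp add: index_seq_def)
    then have "f 0 + Suc e \<le> m" using eq[of e] by simp
    from contig[OF this] show ?thesis
      using minor_cong[of "Suc e" c f "\<lambda>j. j" c "(+) (f 0)" "\<lambda>j. j"] eq
      by (metis less_Suc_eq_le)
  next
    case True
    then obtain k where k: "k < e" "Suc (f k) < f (Suc k)" by blast
    \<comment> \<open>The inserted row is the one right after \<open>f k\<close>. It has position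
      \<open>Suc k\<close> in \<open>g\<close>, and omitting that position gives back
      \<open>f\<close>.\<close>
    define g where "g i = (if i \<le> k then f i else if i = Suc k then Suc (f k) else f (i - 1))" for i
    have fs: "f i < f j" if "i < j" "j \<le> e" for i j
      using f that by (auto simp: index_seq_def)
    have fm: "f i < m" if "i \<le> e" for i using f that by (auto simp: index_seq_def)
    have g: "index_seq (Suc (Suc e)) m g"
    proof (rule index_seq_stepI)
      fix i assume "Suc i < Suc (Suc e)"
      then show "g i < g (Suc i)"
        using k fs[of i "Suc i"] fs[of "i - 1" i] unfolding g_def
        by (cases "i < k"; cases "i = k"; cases "i = Suc k") auto
    next
      fix i assume i: "i < Suc (Suc e)"
      show "g i < m"
        using k i fm[of i] fm[of "i-1"] fm[of "Suc k"] unfolding g_def by auto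
    qed
    have gk: "g \<circ> insert_index (Suc k) = f"
      by (auto simp: g_def insert_index_def fun_eq_iff)
    have "0 < minor (\<lambda>i. c (g i)) (Suc e) (insert_index (Suc k)) (\<lambda>j. j)"
    proof (rule middle_minor_pos)
      fix h assume "index_seq e (Suc (Suc e)) h"
      then show "0 < minor (\<lambda>i. c (g i)) e h (\<lambda>j. j)"
        using small[OF index_seq_comp[OF g]] by (simp add: minor_def)
    next
      have "0 < minor c (Suc e) (g \<circ> Suc) (\<lambda>j. j)"
      proof (rule less.hyps)
        show "index_seq (Suc e) m (g \<circ> Suc)" by (rule index_seq_comp[OF g index_seq_Suc])
        have "(g \<circ> Suc) e = f e" using k by (auto simp: g_def)
        moreover have "f 0 < (g \<circ> Suc) 0" using k fs[of 0 1] by (cases "k = 0") (auto simp: g_def)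
        moreover have "f 0 < f e" using k fs[of 0 e] by auto
        ultimately show "(g \<circ> Suc) e - (g \<circ> Suc) 0 < f e - f 0" by linarith
      qed
      then show "0 < minor (\<lambda>i. c (g i)) (Suc e) Suc (\<lambda>j. j)" by (simp add: minor_def)
    next
      have "0 < minor c (Suc e) g (\<lambda>j. j)"
      proof (rule less.hyps)
        show "index_seq (Suc e) m g" by (rule index_seq_mono[OF g]) simp
        have "g 0 = f 0" by (auto simp: g_def)
        moreover have "g e < f e" using k fs[of "e-1" e] fs[of "Suc k" e]
          by (cases "Suc k = e") (auto simp: g_def)
        moreover have "f 0 < f e" using k fs[of 0 e] by auto
        ultimately show "g e - g 0 < f e - f 0" by linarith
      qed
      then show "0 < minor (\<lambda>i. c (g i)) (Suc e) (\<lambda>j. j) (\<lambda>j. j)" by (simp add: minor_def)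
    qed (use k in auto)
    then show ?thesis using gk[unfolded comp_def fun_eq_iff] by (simp add: minor_def)
  qed
qed

text \<open>Induction on the order, with Fekete's criterion used twice: on the rows over a
  contiguous set of columns, then on the columns, through the transposed array, for arbitrary fixed
  rows.\<close>

lemma minors_pos_if_contiguous_pos:
  assumes contig: "\<And>r i j. i + r \<le> m \<Longrightarrow> j + r \<le> n \<Longrightarrow> 0 < minor c r ((+) i) ((+) j)"
    and "index_seq r m f" "index_seq r n g"
  shows "0 < minor c r f g"
  using assms(2,3)
proof (induction r arbitrary: f g)
  case (Suc r)
  have rows: "0 < minor c (Suc r) f ((+) j)" if f: "index_seq (Suc r) m f" and j: "j + Suc r \<le> n" for f j
  proof -
    have "0 < minor (\<lambda>i k. c i (j + k)) (Suc r) f (\<lambda>j. j)"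
    proof (rule fekete[OF _ _ f])
      fix h assume "index_seq r m h"
      from Suc.IH[OF this index_seq_shift[of j r n]] j
      show "0 < minor (\<lambda>i k. c i (j + k)) r h (\<lambda>j. j)" by (simp add: minor_def)
    next
      fix i assume "i + Suc r \<le> m"
      from contig[OF this j] show "0 < minor (\<lambda>i k. c i (j + k)) (Suc r) ((+) i) (\<lambda>j. j)"
        by (simp add: minor_def)
    qed
    then show ?thesis by (simp add: minor_def)
  qed
  have "0 < minor (\<lambda>j k. c (f k) j) (Suc r) g (\<lambda>j. j)"
  proof (rule fekete[OF _ _ Suc.prems(2)])
    fix h assume "index_seq r n h"
    from Suc.IH[OF index_seq_mono[OF Suc.prems(1)] this]
    show "0 < minor (\<lambda>j k. c (f k) j) r h (\<lambda>j. j)"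
      by (subst minor_swap) (simp add: minor_def)
  next
    fix j assume "j + Suc r \<le> n"
    from rows[OF Suc.prems(1) this]
    show "0 < minor (\<lambda>j k. c (f k) j) (Suc r) ((+) j) (\<lambda>j. j)"
      by (subst minor_swap) (simp add: minor_def)
  qed
  then show ?case by (subst (asm) minor_swap) (simp add: minor_def)
qed simp

section \<open>Sign changes\<close>

lemma sign_changes_Cons_Cons:
  "sign_changes (a # b # xs) = (if a * b < 0 then 1 else 0) + sign_changes (b # xs)"
proof -
  let ?S = "{i. Suc i < length (b # xs) \<and> (b # xs) ! i * (b # xs) ! Suc i < 0}"
  have fin: "finite ?S" by (rule finite_subset[of _ "{..<length (b # xs)}"]) auto
  have "{i. Suc i < length (a # b # xs) \<and> (a # b # xs) ! i * (a # b # xs) ! Suc i < 0} =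
      (if a * b < 0 then {0} else {}) \<union> Suc ` ?S" (is "?T = _")
  proof (rule Set.set_eqI)
    fix i show "i \<in> ?T \<longleftrightarrow> i \<in> (if a * b < 0 then {0} else {}) \<union> Suc ` ?S"
      by (cases i) auto
  qed
  then have "sign_changes (a # b # xs) = card ((if a * b < 0 then {0} else {}) \<union> Suc ` ?S)"
    unfolding sign_changes_def by (rule arg_cong)
  also have "\<dots> = (if a * b < 0 then 1 else 0) + card (Suc ` ?S)"
    using fin by (subst card_Un_disjoint) auto
  also have "card (Suc ` ?S) = card ?S" by (rule card_image) simp
  finally show ?thesis by (simp add: sign_changes_def)
qed

lemma sign_changes_single [simp]: "sign_changes [a] = 0"
  by (simp add: sign_changes_def)

lemma sign_changes_le: "sign_changes xs \<le> length xs - 1"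
proof -
  have "sign_changes xs \<le> card {..<length xs - 1}"
    unfolding sign_changes_def by (rule card_mono) auto
  then show ?thesis by simp
qed

text \<open>Each change flips the sign. This is how the last sign is later obtained from the first
  sign and the number of changes.\<close>

lemma sgn_last_sign_changes:
  assumes "xs \<noteq> []" "0 \<notin> set xs"
  shows "sgn (last xs) = sgn (hd xs) * (-1) ^ sign_changes xs"
  using assms
proof (induction xs rule: induct_list012)
  case (3 a b xs)
  then have "a \<noteq> 0" "b \<noteq> 0" by auto
  then have "sgn b = (if a * b < 0 then - sgn a else sgn a)"
    by (auto simp: sgn_if mult_less_0_iff)
  then show ?case using 3 by (simp add: sign_changes_Cons_Cons)
qed auto

section \<open>Blocks of constant sign\<close>

text \<open>\<open>\<beta>\<close> numbers the blocks of constant sign and \<open>\<epsilon>\<close>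
  is the sign of block 0. At a zero entry the equation holds for any block number, so zeros may join
  any block that keeps \<open>\<beta>\<close> monotone; the last condition puts a nonzero entry into
  each of the \<open>k + 1\<close> blocks.\<close>

definition sign_blocks :: "real list \<Rightarrow> real \<Rightarrow> nat \<Rightarrow> (nat \<Rightarrow> nat) \<Rightarrow> bool" where
  "sign_blocks xs \<epsilon> k \<beta> \<longleftrightarrow>
     (\<forall>i j. i \<le> j \<longrightarrow> j < length xs \<longrightarrow> \<beta> i \<le> \<beta> j) \<and>
     (\<forall>i < length xs. \<beta> i \<le> k \<and> xs ! i = \<epsilon> * (-1) ^ \<beta> i * \<bar>xs ! i\<bar>) \<and>
     (\<forall>l \<le> k. \<exists>i < length xs. \<beta> i = l \<and> xs ! i \<noteq> 0)"

lemma sign_blocks_same_block: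
  assumes "sign_blocks ys \<epsilon> k \<beta>" "a = \<epsilon> * \<bar>a\<bar>"
  shows "sign_blocks (a # ys) \<epsilon> k (case_nat 0 \<beta>)"
  unfolding sign_blocks_def
proof (intro conjI allI impI)
  fix l assume "l \<le> k"
  with assms(1) obtain i where "i < length ys" "\<beta> i = l" "ys ! i \<noteq> 0"
    unfolding sign_blocks_def by blast
  then show "\<exists>i<length (a # ys). case_nat 0 \<beta> i = l \<and> (a # ys) ! i \<noteq> 0"
    by (intro exI[of _ "Suc i"]) auto
next
  fix i j assume "i \<le> j" "j < length (a # ys)"
  then show "case_nat 0 \<beta> i \<le> case_nat 0 \<beta> j"
    using assms(1) by (cases i; cases j) (simp_all add: sign_blocks_def)
next
  fix i assume i: "i < length (a # ys)"
  then show "case_nat 0 \<beta> i \<le> k"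
    using assms(1) by (cases i) (simp_all add: sign_blocks_def)
  show "(a # ys) ! i = \<epsilon> * (-1) ^ case_nat 0 \<beta> i * \<bar>(a # ys) ! i\<bar>"
  proof (cases i)
    case (Suc i')
    then have "ys ! i' = \<epsilon> * (-1) ^ \<beta> i' * \<bar>ys ! i'\<bar>"
      using assms(1) i unfolding sign_blocks_def by auto
    then show ?thesis using Suc by (simp only: nth_Cons_Suc old.nat.case)
  qed (use assms(2) in \<open>simp only: nth_Cons_0 old.nat.case power_0 mult_1_right\<close>)
qed

text \<open>The new entry becomes block 0, so the old block numbers move up by one and the leading
  sign flips; the two changes cancel in \<open>\<epsilon> * (-1) ^ \<beta> i\<close>.\<close>

lemma sign_blocks_new_block:
  assumes "sign_blocks ys \<epsilon> k \<beta>" "a = - \<epsilon> * \<bar>a\<bar>" "a \<noteq> 0"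
  shows "sign_blocks (a # ys) (- \<epsilon>) (Suc k) (case_nat 0 (Suc \<circ> \<beta>))"
  unfolding sign_blocks_def
proof (intro conjI allI impI)
  fix l assume l: "l \<le> Suc k"
  show "\<exists>i<length (a # ys). case_nat 0 (Suc \<circ> \<beta>) i = l \<and> (a # ys) ! i \<noteq> 0"
  proof (cases l)
    case 0
    then show ?thesis using \<open>a \<noteq> 0\<close> by (intro exI[of _ 0]) simp
  next
    case (Suc l')
    with l assms(1) obtain i where "i < length ys" "\<beta> i = l'" "ys ! i \<noteq> 0"
      unfolding sign_blocks_def by (meson Suc_le_mono)
    then show ?thesis using Suc by (intro exI[of _ "Suc i"]) simp
  qed
next
  fix i j assume "i \<le> j" "j < length (a # ys)"
  then show "case_nat 0 (Suc \<circ> \<beta>) i \<le> case_nat 0 (Suc \<circ> \<beta>) j"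
    using assms(1) by (cases i; cases j) (simp_all add: sign_blocks_def)
next
  fix i assume i: "i < length (a # ys)"
  then show "case_nat 0 (Suc \<circ> \<beta>) i \<le> Suc k"
    using assms(1) by (cases i) (simp_all add: sign_blocks_def)
  show "(a # ys) ! i = - \<epsilon> * (-1) ^ case_nat 0 (Suc \<circ> \<beta>) i * \<bar>(a # ys) ! i\<bar>"
  proof (cases i)
    case (Suc i')
    then have "ys ! i' = \<epsilon> * (-1) ^ \<beta> i' * \<bar>ys ! i'\<bar>"
      using assms(1) i unfolding sign_blocks_def by auto
    also have "\<dots> = - \<epsilon> * (-1) ^ Suc (\<beta> i') * \<bar>ys ! i'\<bar>" by simp
    finally show ?thesis using Suc by (simp only: nth_Cons_Suc old.nat.case comp_apply)
  qed (use assms(2) in \<open>simp only: nth_Cons_0 old.nat.case power_0 mult_1_right\<close>)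
qed

text \<open>Induction from the back of the list: a new front entry that is zero or has the sign of
  the next nonzero entry joins block 0, any other opens a block.\<close>

lemma sign_blocks_exist:
  fixes xs :: "real list"
  assumes "filter (\<lambda>a. a \<noteq> 0) xs \<noteq> []"
  shows "\<exists>\<beta>. sign_blocks xs (sgn (hd (filter (\<lambda>a. a \<noteq> 0) xs)))
            (sign_changes (filter (\<lambda>a. a \<noteq> 0) xs)) \<beta>"
  using assms
proof (induction xs)
  case (Cons a ys)
  let ?zs = "filter (\<lambda>a. a \<noteq> 0) ys"
  show ?case
  proof (cases "?zs = []")
    case True
    then have "ys ! i = 0" if "i < length ys" for i
      using that by (auto simp: filter_empty_conv)
    moreover have "a \<noteq> 0" using Cons.prems True by auto
    ultimately have "sign_blocks (a # ys) (sgn a) 0 (\<lambda>_. 0)"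
      by (auto simp: sign_blocks_def nth_Cons sgn_mult_abs[symmetric] split: nat.splits)
    with True \<open>a \<noteq> 0\<close> show ?thesis by auto
  next
    case False
    then obtain b bs where zs: "?zs = b # bs" by (cases ?zs) auto
    then have "b \<in> set ?zs" by simp
    then have "b \<noteq> 0" by simp
    from Cons.IH[OF False] obtain \<beta> where \<beta>: "sign_blocks ys (sgn b) (sign_changes ?zs) \<beta>"
      using zs by auto
    consider "a = 0" | "a \<noteq> 0" "sgn a = sgn b" | "a \<noteq> 0" "sgn a = - sgn b"
      using \<open>b \<noteq> 0\<close> by (cases "a = 0"; cases "0 < a"; cases "0 < b") (auto simp: sgn_if)
    then show ?thesis
    proof cases
      case 1
      then show ?thesis using sign_blocks_same_block[OF \<beta>, of a] zs by auto
    next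
      case 2
      then have "\<not> a * b < 0" using \<open>b \<noteq> 0\<close>
        by (auto simp: sgn_if mult_less_0_iff split: if_splits)
      then show ?thesis
        using 2 sign_blocks_same_block[OF \<beta>, of a] zs
        by (auto simp: sign_changes_Cons_Cons) (metis sgn_mult_abs)
    next
      case 3
      then have "a * b < 0" using \<open>b \<noteq> 0\<close>
        by (auto simp: sgn_if mult_less_0_iff split: if_splits)
      moreover have "a = - sgn b * \<bar>a\<bar>" using 3 by (metis sgn_mult_abs)
      ultimately show ?thesis
        using 3 sign_blocks_new_block[OF \<beta>, of a] zs by (auto simp: sign_changes_Cons_Cons)
    qed
  qed
qed simp

lemma nonzero_entries_eq_list:
  assumes "\<And>i. i < dim_vec w \<Longrightarrow> w $ i \<noteq> 0"
  shows "nonzero_entries w = list_of_vec w"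
  unfolding nonzero_entries_def by (rule filter_True) (use assms in \<open>auto simp: list_of_vec_map\<close>)

lemma hd_list_of_vec: "0 < dim_vec w \<Longrightarrow> hd (list_of_vec w) = w $ 0"
  by (simp add: list_of_vec_map hd_map)

lemma last_list_of_vec: "0 < dim_vec w \<Longrightarrow> last (list_of_vec w) = w $ (dim_vec w - 1)"
  by (simp add: list_of_vec_map last_map)

lemma list_of_vec_eq_Nil_iff: "list_of_vec w = [] \<longleftrightarrow> dim_vec w = 0"
  by (simp only: length_0_conv[symmetric] length_list_of_vec)

lemma nonzero_vec_blocks:
  assumes "\<And>i. i < dim_vec w \<Longrightarrow> w $ i \<noteq> 0" "0 < dim_vec w"
  obtains \<beta> where "sign_blocks (list_of_vec w) (sgn (w $ 0)) (sign_changes (list_of_vec w)) \<beta>"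
proof -
  have "filter (\<lambda>a. a \<noteq> 0) (list_of_vec w) = list_of_vec w"
    using nonzero_entries_eq_list[of w] assms(1) by (simp add: nonzero_entries_def)
  moreover have "list_of_vec w \<noteq> []"
    using assms(2) list_of_vec_eq_Nil_iff by (metis less_numeral_extra(3))
  ultimately show ?thesis
    using sign_blocks_exist[of "list_of_vec w"] hd_list_of_vec[OF assms(2)] that by metis
qed

text \<open>One position is chosen in each block; monotonicity of the block numbers makes the
  positions increase.\<close>

lemma alternating_subsequence:
  assumes "\<And>i. i < dim_vec w \<Longrightarrow> w $ i \<noteq> 0" "0 < dim_vec w"
  obtains f where "index_seq (Suc (sign_changes (list_of_vec w))) (dim_vec w) f"
    "\<And>l. l \<le> sign_changes (list_of_vec w) \<Longrightarrow> 0 < sgn (w $ 0) * (-1) ^ l * w $ f l"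
proof -
  obtain \<beta> where \<beta>: "sign_blocks (list_of_vec w) (sgn (w $ 0)) (sign_changes (list_of_vec w)) \<beta>"
    by (rule nonzero_vec_blocks[OF assms])
  let ?k = "sign_changes (list_of_vec w)"
  have "\<forall>l\<in>{..?k}. \<exists>i. i < dim_vec w \<and> \<beta> i = l"
    using \<beta> unfolding sign_blocks_def by auto
  then obtain f where f: "\<And>l. l \<le> ?k \<Longrightarrow> f l < dim_vec w \<and> \<beta> (f l) = l"
    unfolding bchoice_iff by auto
  have mono: "i \<le> j \<Longrightarrow> j < dim_vec w \<Longrightarrow> \<beta> i \<le> \<beta> j" for i j
    using \<beta> by (simp add: sign_blocks_def)
  have "index_seq (Suc ?k) (dim_vec w) f"
    unfolding index_seq_def
  proof (intro conjI allI impI)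
    fix i j assume ij: "i < j" "j < Suc ?k"
    show "f i < f j"
    proof (rule ccontr)
      assume "\<not> f i < f j"
      then have "\<beta> (f j) \<le> \<beta> (f i)" using mono[of "f j" "f i"] f[of i] ij by simp
      then show False using f[of i] f[of j] ij by simp
    qed
  qed (use f in auto)
  moreover have "0 < sgn (w $ 0) * (-1) ^ l * w $ f l" if "l \<le> ?k" for l
  proof -
    have "w $ f l = sgn (w $ 0) * (-1) ^ l * \<bar>w $ f l\<bar>"
      using \<beta> f[OF that] by (auto simp: sign_blocks_def list_of_vec_index)
    then have "sgn (w $ 0) * (-1) ^ l * w $ f l =
        (sgn (w $ 0) * (-1) ^ l) * (sgn (w $ 0) * (-1) ^ l) * \<bar>w $ f l\<bar>"
      by (metis mult.assoc)
    also have "(sgn (w $ 0) * (-1) ^ l) * (sgn (w $ 0) * (-1) ^ l) = 1"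
      using assms by (simp add: sgn_if power_mult_distrib[symmetric])
    finally show ?thesis using f[OF that] assms by simp
  qed
  ultimately show ?thesis by (rule that)
qed

text \<open>Two entries of one block cannot have opposite signs, so the block number rises strictly
  along \<open>f\<close> and reaches at least \<open>q\<close>.\<close>

lemma sign_changes_ge_alternating:
  assumes nz: "\<And>i. i < dim_vec w \<Longrightarrow> w $ i \<noteq> 0"
    and f: "index_seq (Suc q) (dim_vec w) f"
    and alt: "\<And>l. l \<le> q \<Longrightarrow> 0 < \<delta> * (-1) ^ l * w $ f l"
  shows "q \<le> sign_changes (list_of_vec w)"
proof -
  have fm: "f l < dim_vec w" if "l \<le> q" for l using f that by (auto simp: index_seq_def)
  obtain \<beta> where \<beta>: "sign_blocks (list_of_vec w) (sgn (w $ 0)) (sign_changes (list_of_vec w)) \<beta>"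
    by (rule nonzero_vec_blocks[of w]) (use nz fm[of 0] in auto)
  have val: "w $ f l = sgn (w $ 0) * (-1) ^ \<beta> (f l) * \<bar>w $ f l\<bar>" if "l \<le> q" for l
    using \<beta> fm[OF that] by (auto simp: sign_blocks_def list_of_vec_index)
  have "l \<le> q \<Longrightarrow> l \<le> \<beta> (f l)" for l
  proof (induction l)
    case (Suc l)
    have "f l < f (Suc l)" using f Suc.prems by (auto simp: index_seq_def)
    then have "\<beta> (f l) \<le> \<beta> (f (Suc l))"
      using \<beta> fm[OF Suc.prems] by (auto simp: sign_blocks_def)
    moreover have "\<beta> (f l) \<noteq> \<beta> (f (Suc l))"
    proof
      assume eq: "\<beta> (f l) = \<beta> (f (Suc l))"
      define \<sigma> where "\<sigma> = sgn (w $ 0) * (-1) ^ \<beta> (f l)"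
      have "w $ f l = \<sigma> * \<bar>w $ f l\<bar>" "w $ f (Suc l) = \<sigma> * \<bar>w $ f (Suc l)\<bar>"
        using val[of l] val[of "Suc l"] Suc.prems eq by (simp_all add: \<sigma>_def)
      then have "w $ f l * w $ f (Suc l) = (\<sigma> * \<bar>w $ f l\<bar>) * (\<sigma> * \<bar>w $ f (Suc l)\<bar>)"
        by (rule arg_cong2)
      also have "\<dots> = \<sigma>\<^sup>2 * (\<bar>w $ f l\<bar> * \<bar>w $ f (Suc l)\<bar>)"
        by (simp only: power2_eq_square mult.assoc mult.left_commute)
      finally have prod_nonneg: "0 \<le> w $ f l * w $ f (Suc l)" by simp
      have "0 < (\<delta> * (-1) ^ l * w $ f l) * (\<delta> * (-1) ^ Suc l * w $ f (Suc l))"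
        by (rule mult_pos_pos[OF alt[of l] alt[of "Suc l"]]) (use Suc.prems in auto)
      also have "\<dots> = - ((\<delta> * (-1) ^ l)\<^sup>2 * (w $ f l * w $ f (Suc l)))"
        by (simp add: power2_eq_square)
      finally show False
        using mult_nonneg_nonneg[OF zero_le_power2 prod_nonneg, of "\<delta> * (-1) ^ l"] by linarith
    qed
    ultimately show ?case using Suc by linarith
  qed simp
  then have "q \<le> \<beta> (f q)" by simp
  also have "\<dots> \<le> sign_changes (list_of_vec w)"
    using \<beta> fm[of q] by (auto simp: sign_blocks_def)
  finally show ?thesis .
qed

section \<open>Sign assignments to zero entries\<close>

lemma zero_assignments_cases:
  assumes "w \<in> zero_assignments v" "i < dim_vec v"
  shows "v $ i = 0 \<Longrightarrow> w $ i \<in> {-1, 1}" "v $ i \<noteq> 0 \<Longrightarrow> w $ i = v $ i"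
proof -
  have "if v $ i = 0 then w $ i \<in> {-1, 1} else w $ i = v $ i"
    using assms unfolding zero_assignments_def by blast
  then show "v $ i = 0 \<Longrightarrow> w $ i \<in> {-1, 1}" "v $ i \<noteq> 0 \<Longrightarrow> w $ i = v $ i"
    by (simp_all only: if_True if_False)
qed

lemma zero_assignments_nonzero:
  assumes "w \<in> zero_assignments v"
  shows "dim_vec w = dim_vec v" "i < dim_vec v \<Longrightarrow> w $ i \<noteq> 0"
proof -
  show "dim_vec w = dim_vec v" using assms by (simp add: zero_assignments_def)
  show "w $ i \<noteq> 0" if "i < dim_vec v"
    using zero_assignments_cases[OF assms that] by (cases "v $ i = 0") auto
qed

lemma finite_sign_changes_assignments:
  "finite ((\<lambda>w. sign_changes (list_of_vec w)) ` zero_assignments v)"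
proof (rule finite_subset[of _ "{..dim_vec v}"])
  show "(\<lambda>w. sign_changes (list_of_vec w)) ` zero_assignments v \<subseteq> {..dim_vec v}"
  proof (intro image_subsetI)
    fix w assume "w \<in> zero_assignments v"
    then show "sign_changes (list_of_vec w) \<in> {..dim_vec v}"
      using sign_changes_le[of "list_of_vec w"] zero_assignments_nonzero(1) by force
  qed
qed simp

lemma S_plus_ge:
  assumes "v \<noteq> 0\<^sub>v (dim_vec v)" "w \<in> zero_assignments v"
  shows "sign_changes (list_of_vec w) \<le> S_plus v"
  unfolding S_plus_def using assms
  by (simp only: if_False) (rule Max_ge[OF finite_sign_changes_assignments imageI])

lemma S_plus_attained:
  assumes "v \<noteq> 0\<^sub>v (dim_vec v)"
  obtains w where "w \<in> zero_assignments v" "sign_changes (list_of_vec w) = S_plus v"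
proof -
  \<comment> \<open>Putting 1 at all zeros shows that the maximum is taken over a nonempty
    set.\<close>
  have "vec (dim_vec v) (\<lambda>i. if v $ i = 0 then 1 else v $ i) \<in> zero_assignments v"
    by (auto simp: zero_assignments_def)
  then have "S_plus v \<in> (\<lambda>w. sign_changes (list_of_vec w)) ` zero_assignments v"
    using assms Max_in[OF finite_sign_changes_assignments[of v]] by (auto simp: S_plus_def)
  then show ?thesis using that by auto
qed

text \<open>The zeros along \<open>f\<close> can be filled with the signs that make the alternation
  strict.\<close>

lemma S_plus_ge_weakly_alternating:
  assumes v: "v \<in> carrier_vec m" "v \<noteq> 0\<^sub>v m"
    and f: "index_seq (Suc q) m f"
    and \<delta>: "\<delta> \<in> {-1, 1}"
    and alt: "\<And>l. l \<le> q \<Longrightarrow> 0 \<le> \<delta> * (-1) ^ l * v $ f l"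
  shows "q \<le> S_plus v"
proof -
  have m: "dim_vec v = m" using v by auto
  have inj: "inj_on f {..q}"
    using index_seq_inj_on[OF f] by (simp only: lessThan_Suc_atMost)
  \<comment> \<open>The inverse of \<open>f\<close> recovers \<open>l\<close> from the index
    \<open>f l\<close>. Outside the range of \<open>f\<close> its value is unspecified, but
    \<open>s\<close> is still 1 or -1.\<close>
  define s where "s i = \<delta> * (-1) ^ the_inv_into {..q} f i" for i
  have sf: "s (f l) = \<delta> * (-1) ^ l" if "l \<le> q" for l
    using the_inv_into_f_f[OF inj] that by (simp add: s_def)
  have s1: "s i \<in> {-1, 1}" for i
    using \<delta> by (cases "even (the_inv_into {..q} f i)") (auto simp: s_def)
  define w where "w = vec m (\<lambda>i. if v $ i = 0 then s i else v $ i)"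
  have w: "w \<in> zero_assignments v" using m s1 by (auto simp: zero_assignments_def w_def)
  have "q \<le> sign_changes (list_of_vec w)"
  proof (rule sign_changes_ge_alternating)
    show "w $ i \<noteq> 0" if "i < dim_vec w" for i
      using zero_assignments_nonzero[OF w] that by simp
    show "index_seq (Suc q) (dim_vec w) f" using f by (simp add: w_def)
    fix l assume l: "l \<le> q"
    have fl: "f l < m" using f l by (auto simp: index_seq_def)
    show "0 < \<delta> * (-1) ^ l * w $ f l"
    proof (cases "v $ f l = 0")
      case True
      then have "\<delta> * (-1) ^ l * w $ f l = (\<delta> * (-1) ^ l)\<^sup>2"
        using fl sf[OF l] by (simp add: w_def power2_eq_square)
      then show ?thesis using \<delta> by auto
    next
      case False
      then have "w $ f l = v $ f l" using fl by (simp add: w_def)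
      moreover have "\<delta> * (-1) ^ l * v $ f l \<noteq> 0" using False \<delta> by auto
      ultimately show ?thesis using alt[OF l] order_le_neq_trans by metis
    qed
  qed
  also have "\<dots> \<le> S_plus v" by (rule S_plus_ge) (use v m w in auto)
  finally show ?thesis .
qed

text \<open>Where \<open>w\<close> differs from \<open>v\<close>, the entry of \<open>v\<close> is
  0, so an alternating subsequence of \<open>w\<close> is weakly alternating in \<open>v\<close>.
  Its initial sign is that of \<open>w $ 0\<close>, the sign that the end condition is
  about.\<close>

lemma S_plus_weakly_alternating:
  assumes v: "v \<in> carrier_vec m"
    and w: "w \<in> zero_assignments v" and m: "0 < m"
  obtains f where "index_seq (Suc (sign_changes (list_of_vec w))) m f"
    "\<And>l. l \<le> sign_changes (list_of_vec w) \<Longrightarrow> 0 \<le> sgn (w $ 0) * (-1) ^ l * v $ f l"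
proof -
  have dim: "dim_vec w = m" "dim_vec v = m" using zero_assignments_nonzero[OF w] v by auto
  obtain f where f: "index_seq (Suc (sign_changes (list_of_vec w))) m f"
    and alt: "\<And>l. l \<le> sign_changes (list_of_vec w) \<Longrightarrow> 0 < sgn (w $ 0) * (-1) ^ l * w $ f l"
    using alternating_subsequence[of w] zero_assignments_nonzero[OF w] dim m by metis
  show ?thesis
  proof (rule that[OF f])
    fix l assume l: "l \<le> sign_changes (list_of_vec w)"
    then have "f l < m" using f by (auto simp: index_seq_def)
    then have "v $ f l = 0 \<or> v $ f l = w $ f l"
      using zero_assignments_cases(2)[OF w] dim by metis
    then show "0 \<le> sgn (w $ 0) * (-1) ^ l * v $ f l" using alt[OF l] by auto
  qed
qed

text \<open>Maximising assignments exist, so a sign common to all of them is the one that the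
  definite description picks; at a nonzero entry every assignment keeps
  \<open>v $ i\<close>.\<close>

lemma S_plus_sign_eqI:
  assumes v: "v \<noteq> 0\<^sub>v (dim_vec v)" and i: "i < dim_vec v"
    and s: "\<And>w. w \<in> zero_assignments v \<Longrightarrow> sign_changes (list_of_vec w) = S_plus v \<Longrightarrow>
            sgn (w $ i) = s"
  shows "S_plus_sign v i = s"
proof -
  obtain w where w: "w \<in> zero_assignments v" "sign_changes (list_of_vec w) = S_plus v"
    by (rule S_plus_attained[OF v])
  show ?thesis
  proof (cases "v $ i = 0")
    case True
    have val: "w' $ i = s \<and> s \<in> {-1, 1}"
      if "w' \<in> zero_assignments v" "sign_changes (list_of_vec w') = S_plus v" for w'
      using s[OF that] zero_assignments_cases(1)[OF that(1) i True] by auto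
    have "(THE s. s \<in> {-1, 1} \<and> (\<forall>w \<in> zero_assignments v.
        sign_changes (list_of_vec w) = S_plus v \<longrightarrow> w $ i = s)) = s"
      by (rule the_equality) (use val w in auto)
    then show ?thesis using True by (simp add: S_plus_sign_def)
  next
    case False
    then show ?thesis using s[OF w] zero_assignments_cases(2)[OF w(1) i] by (simp add: S_plus_sign_def)
  qed
qed

section \<open>Vectors with a peak followed by zeros\<close>

text \<open>The entry at \<open>i\<close> followed by \<open>d\<close> zeros already yields
  \<open>d\<close> changes, so the bound \<open>S_plus v \<le> d\<close> leaves no room for another
  one. Entries outside this window that could add a change are excluded, which fixes the sign of
  component 0.\<close>

lemma S_plus_single_peak:
  assumes v: "v \<in> carrier_vec m" and i: "i + Suc d \<le> m"
    and zero: "\<And>l. 0 < l \<Longrightarrow> l \<le> d \<Longrightarrow> v $ (i + l) = 0"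
    and le: "S_plus v \<le> d"
  shows "v \<noteq> 0\<^sub>v m" "S_plus v = d" "v $ i \<noteq> 0" "S_plus_sign v 0 = sgn (v $ i)"
proof -
  have m: "dim_vec v = m" using v by auto
  show nz: "v \<noteq> 0\<^sub>v m"
  proof
    assume "v = 0\<^sub>v m"
    \<comment> \<open>This is the convention for the zero vector, and \<open>m\<close> exceeds
      \<open>d\<close>.\<close>
    then have "S_plus v = m" by (simp add: S_plus_def)
    with le i show False by simp
  qed
  note chain = S_plus_ge_weakly_alternating[OF v nz]
  \<comment> \<open>An earlier entry weakly opposite to \<open>v $ i\<close> would start a weakly
    alternating sequence of \<open>d + 2\<close> entries.\<close>
  have extend: False
    if t: "t < i" and \<delta>: "\<delta> \<in> {-1, 1}" and "0 \<le> \<delta> * v $ t" "\<delta> * v $ i \<le> 0" for t \<delta>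
  proof -
    have "Suc d \<le> S_plus v"
    proof (rule chain[where f = "case_nat t (\<lambda>l. i + l)" and \<delta> = \<delta>])
      show "index_seq (Suc (Suc d)) m (case_nat t (\<lambda>l. i + l))"
        using t i by (auto simp: index_seq_def split: nat.splits)
      fix l assume "l \<le> Suc d"
      then show "0 \<le> \<delta> * (-1) ^ l * v $ case_nat t (\<lambda>l. i + l) l"
        using that zero by (cases l; cases "l = 1") auto
    qed (rule \<delta>)
    with le show False by simp
  qed
  show vi: "v $ i \<noteq> 0"
  proof
    assume vi: "v $ i = 0"
    \<comment> \<open>With \<open>v $ i = 0\<close> the whole window is zero, so a nonzero entry
      lies before or after it; either way it extends the alternation.\<close>
    obtain t where t: "t < m" "v $ t \<noteq> 0" using nz v m eq_vecI[of v "0\<^sub>v m"] by auto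
    have "\<not> (i \<le> t \<and> t < i + Suc d)"
    proof
      assume "i \<le> t \<and> t < i + Suc d"
      then have "v $ t = 0" using zero[of "t - i"] vi by (cases "t = i") auto
      with t show False by simp
    qed
    then consider "t < i" | "i + Suc d \<le> t" by linarith
    then show False
    proof cases
      case 1
      then show False
        by (rule extend[of t "sgn (v $ t)"]) (use t vi in \<open>auto simp: sgn_if\<close>)
    next
      case 2
      have "Suc d \<le> S_plus v"
      \<comment> \<open>\<open>\<delta>\<close> is chosen so that the final sign
        \<open>\<delta> * (-1) ^ Suc d\<close> is that of \<open>v $ t\<close>.\<close>
      proof (rule chain[where f = "\<lambda>l. if l \<le> d then i + l else t"
            and \<delta> = "sgn (v $ t) * (-1) ^ Suc d"])
        show "index_seq (Suc (Suc d)) m (\<lambda>l. if l \<le> d then i + l else t)"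
          using 2 t by (auto simp: index_seq_def)
        show "sgn (v $ t) * (-1) ^ Suc d \<in> {-1, 1}"
          using t by (cases "even d") (auto simp: sgn_if)
        fix l assume l: "l \<le> Suc d"
        have pw: "(-1) ^ Suc d * (-1) ^ Suc d = (1::real)"
          by (simp add: power_mult_distrib[symmetric])
        show "0 \<le> sgn (v $ t) * (-1) ^ Suc d * (-1) ^ l * v $ (if l \<le> d then i + l else t)"
        proof (cases "l \<le> d")
          case True
          then show ?thesis using zero[of l] vi by (cases "l = 0") auto
        next
          case False
          with l have "l = Suc d" by simp
          then show ?thesis using pw by (simp add: mult.assoc sgn_if)
        qed
      qed
      with le show False by simp
    qed
  qed
  have "d \<le> S_plus v"
  proof (rule chain[where f = "(+) i" and \<delta> = "sgn (v $ i)"])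
    show "sgn (v $ i) \<in> {-1, 1}" using vi by (auto simp: sgn_if)
    fix l assume "l \<le> d"
    then show "0 \<le> sgn (v $ i) * (-1) ^ l * v $ (i + l)"
      using zero[of l] by (cases "l = 0") (auto simp: sgn_if)
  qed (rule index_seq_shift[OF i])
  with le show "S_plus v = d" by simp
  \<comment> \<open>Otherwise \<open>v $ 0\<close> is zero or opposite to \<open>v $ i\<close> and
    extends the alternation.\<close>
  have "sgn (v $ 0) = sgn (v $ i)"
  proof (rule ccontr)
    assume ne: "sgn (v $ 0) \<noteq> sgn (v $ i)"
    then have "0 < i" by (cases i) auto
    then show False
      using extend[of 0 "- sgn (v $ i)"] ne vi by (auto simp: sgn_if split: if_splits)
  qed
  moreover from this vi have "v $ 0 \<noteq> 0" by (auto simp: sgn_if split: if_splits)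
  ultimately show "S_plus_sign v 0 = sgn (v $ i)" by (simp add: S_plus_sign_def)
qed

text \<open>\<open>S_minus x\<close> is at most \<open>d\<close> because \<open>x\<close> has at
  most \<open>d + 1\<close> nonzero entries, whereas the peak forces \<open>S_plus v = d\<close>. So
  equality holds and the sign of \<open>t\<close> passes to the peak. Only the nonzero entries of
  \<open>x\<close> enter, which covers a test vector and its padding with zeros alike.\<close>

lemma peak_pos:
  assumes v: "v \<in> carrier_vec m" and i: "i + Suc d \<le> m"
    and zero: "\<And>l. 0 < l \<Longrightarrow> l \<le> d \<Longrightarrow> v $ (i + l) = 0"
    and x: "nonzero_entries x = filter (\<lambda>a. a \<noteq> 0) (t # ts)" "length ts = d" "0 < t"
    and le: "S_plus v \<le> S_minus x"
    and eq: "S_plus v = S_minus x \<Longrightarrow> v \<noteq> 0\<^sub>v m \<Longrightarrow> end_signs_agree v x"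
  shows "0 < v $ i"
proof -
  have "length (nonzero_entries x) \<le> Suc d"
    unfolding x(1) using length_filter_le[of "\<lambda>a. a \<noteq> 0" "t # ts"] x(2)
    by (simp only: list.size)
  then have "S_minus x \<le> d"
    using sign_changes_le[of "nonzero_entries x"] by (simp add: S_minus_def)
  with le have le_d: "S_plus v \<le> d" by simp
  have peak: "v \<noteq> 0\<^sub>v m" "S_plus v = d" "S_plus_sign v 0 = sgn (v $ i)"
    by (rule S_plus_single_peak[OF v i _ le_d]; use zero in blast)+
  have "S_plus v = S_minus x" using peak(2) \<open>S_minus x \<le> d\<close> le by simp
  from eq[OF this peak(1)] have "sgn (v $ i) = sgn t"
    using peak(3) x by (simp add: end_signs_agree_def)
  then show ?thesis using x(3) by (simp add: sgn_if split: if_splits)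
qed

section \<open>Variation diminution\<close>

text \<open>Linearity in column \<open>t\<close>: in the expansion along that column the cofactors
  do not depend on it.\<close>

lemma minor_column_sum:
  fixes u v :: "nat \<Rightarrow> nat \<Rightarrow> real"
  assumes "t < r" "finite Q"
  shows "det (mat r r (\<lambda>(i,l). if l = t then (\<Sum>q\<in>Q. w q * u i q) else v i l)) =
     (\<Sum>q\<in>Q. w q * det (mat r r (\<lambda>(i,l). if l = t then u i q else v i l)))"
proof -
  have del: "mat_delete (mat r r (\<lambda>(i,l). if l = t then g i else v i l)) p t =
      mat_delete (mat r r (\<lambda>(i,l). v i l)) p t" if "p < r" for p and g :: "nat \<Rightarrow> real"
    using that assms(1) by (intro eq_matI) (auto simp: mat_delete_def)
  have ex: "det (mat r r (\<lambda>(i,l). if l = t then g i else v i l)) =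
      (\<Sum>p<r. g p * cofactor (mat r r (\<lambda>(i,l). v i l)) p t)" for g :: "nat \<Rightarrow> real"
    by (subst laplace_expansion_column[of _ r t])
       (use assms(1) in \<open>auto simp: cofactor_def del intro!: sum.cong\<close>)
  show ?thesis
    unfolding ex by (simp add: sum_distrib_left sum_distrib_right mult.assoc) (rule sum.swap)
qed

text \<open>Multilinearity expands the minor into positive multiples of minors of \<open>c\<close>
  with one column from each \<open>Q l\<close>; the order of these sets makes the chosen columns
  increase.\<close>

lemma block_minor_pos:
  assumes pos: "\<And>g. index_seq r n g \<Longrightarrow> 0 < minor c r f g"
    and Q: "\<And>l. l < r \<Longrightarrow> Q l \<noteq> {}" "\<And>l. l < r \<Longrightarrow> Q l \<subseteq> {..<n}"
    and ord: "\<And>l l' p q. l < l' \<Longrightarrow> l' < r \<Longrightarrow> p \<in> Q l \<Longrightarrow> q \<in> Q l' \<Longrightarrow> p < q"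
    and w: "\<And>l q. l < r \<Longrightarrow> q \<in> Q l \<Longrightarrow> 0 < w q"
  shows "0 < minor (\<lambda>i l. \<Sum>q\<in>Q l. w q * c i q) r f (\<lambda>l. l)"
proof -
  \<comment> \<open>Hybrid matrix: the first \<open>t\<close> columns are already sums, the others
    are single columns picked by \<open>g\<close>. Induction on \<open>t\<close> replaces one column
    at a time.\<close>
  have "0 < det (mat r r (\<lambda>(i,l). if l < t then (\<Sum>q\<in>Q l. w q * c (f i) q) else c (f i) (g l)))"
    if "t \<le> r" "\<forall>l<r. t \<le> l \<longrightarrow> g l \<in> Q l" for t g
    using that
  proof (induction t arbitrary: g)
    case 0
    then have "index_seq r n g" using Q ord unfolding index_seq_def by (meson lessThan_iff less_trans subsetD zero_le)
    from pos[OF this] show ?case by (simp add: minor_def)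
  next
    case (Suc t)
    then have t: "t < r" by simp
    have fin: "finite (Q t)" using Q(2)[OF t] finite_subset by blast
    have "mat r r (\<lambda>(i,l). if l < Suc t then (\<Sum>q\<in>Q l. w q * c (f i) q) else c (f i) (g l)) =
        mat r r (\<lambda>(i,l). if l = t then (\<Sum>q\<in>Q t. w q * c (f i) q)
           else if l < t then (\<Sum>q\<in>Q l. w q * c (f i) q) else c (f i) (g l))"
      by (auto intro!: eq_matI)
    moreover have "0 < (\<Sum>q\<in>Q t. w q * det (mat r r (\<lambda>(i,l). if l = t then c (f i) q
           else if l < t then (\<Sum>q\<in>Q l. w q * c (f i) q) else c (f i) (g l))))"
    proof (rule sum_pos[OF fin Q(1)[OF t]])
      fix q assume q: "q \<in> Q t"
      have "mat r r (\<lambda>(i,l). if l = t then c (f i) q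
           else if l < t then (\<Sum>q\<in>Q l. w q * c (f i) q) else c (f i) (g l)) =
         mat r r (\<lambda>(i,l). if l < t then (\<Sum>q\<in>Q l. w q * c (f i) q) else c (f i) ((g(t := q)) l))"
        by (auto intro!: eq_matI)
      moreover have "0 < det (mat r r (\<lambda>(i,l).
          if l < t then (\<Sum>q\<in>Q l. w q * c (f i) q) else c (f i) ((g(t := q)) l)))"
        by (rule Suc.IH) (use Suc.prems q in auto)
      ultimately have "0 < det (mat r r (\<lambda>(i,l). if l = t then c (f i) q
           else if l < t then (\<Sum>q\<in>Q l. w q * c (f i) q) else c (f i) (g l)))"
        by (simp only:)
      then show "0 < w q * det (mat r r (\<lambda>(i,l). if l = t then c (f i) q
           else if l < t then (\<Sum>q\<in>Q l. w q * c (f i) q) else c (f i) (g l)))"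
        by (rule mult_pos_pos[OF w[OF t q]])
    qed
    ultimately show ?case by (simp only: minor_column_sum[OF t fin])
  qed
  \<comment> \<open>At \<open>t = r\<close> no column is picked by \<open>g\<close>, so any
    \<open>g\<close> will do.\<close>
  from this[of r "\<lambda>_. 0"] have "0 < det (mat r r (\<lambda>(i,l).
      if l < r then (\<Sum>q\<in>Q l. w q * c (f i) q) else c (f i) 0))"
    by simp
  also have "mat r r (\<lambda>(i,l). if l < r then (\<Sum>q\<in>Q l. w q * c (f i) q) else c (f i) 0) =
      mat r r (\<lambda>(i,l). \<Sum>q\<in>Q l. w q * c (f i) q)"
    by (auto intro!: eq_matI)
  finally show ?thesis by (simp add: minor_def)
qed

text \<open>Cramer's rule for the first unknown: the signed minors that omit column 0 annihilate
  every other column, and on column 0 they give the expansion of the determinant.\<close>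

lemma cramer_first:
  assumes "\<And>i. i < Suc k \<Longrightarrow> y (f i) = (\<Sum>q<Suc k. b (f i) q * s q)"
  shows "(\<Sum>i<Suc k. (-1) ^ i * y (f i) * minor b k (f \<circ> insert_index i) Suc) =
     s 0 * minor b (Suc k) f (\<lambda>l. l)"
proof -
  let ?D = "\<lambda>i. minor b k (f \<circ> insert_index i) Suc"
  have null: "(\<Sum>i<Suc k. (-1) ^ i * b (f i) (Suc q) * ?D i) = 0" if "q < k" for q
    using alternating_minors_left_null[OF that, of b f Suc] .
  have "(\<Sum>i<Suc k. (-1) ^ i * y (f i) * ?D i) =
      (\<Sum>i<Suc k. \<Sum>q<Suc k. s q * ((-1) ^ i * b (f i) q * ?D i))"
    using assms
    by (intro sum.cong) (auto simp: sum_distrib_left sum_distrib_right algebra_simps simp del: sum.lessThan_Suc)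
  also have "\<dots> = (\<Sum>q<Suc k. s q * (\<Sum>i<Suc k. (-1) ^ i * b (f i) q * ?D i))"
    unfolding sum_distrib_left by (rule sum.swap)
  also have "\<dots> = s 0 * (\<Sum>i<Suc k. (-1) ^ i * b (f i) 0 * ?D i) +
      (\<Sum>q<k. s (Suc q) * (\<Sum>i<Suc k. (-1) ^ i * b (f i) (Suc q) * ?D i))"
    by (rule sum.lessThan_Suc_shift)
  also have "(\<Sum>q<k. s (Suc q) * (\<Sum>i<Suc k. (-1) ^ i * b (f i) (Suc q) * ?D i)) = 0"
    by (intro sum.neutral ballI) (simp only: null lessThan_iff mult_zero_right)
  also have "(\<Sum>i<Suc k. (-1) ^ i * b (f i) 0 * ?D i) = minor b (Suc k) f (\<lambda>l. l)"
    unfolding minor_laplace by (simp add: comp_def)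
  finally show ?thesis by (simp only: add_0_right)
qed

text \<open>If \<open>y\<close> alternates weakly along \<open>f\<close>, no term of Cramer's
  formula for \<open>s 0\<close> has the sign opposite to \<open>\<delta>\<close>. For
  \<open>k + 2\<close> rows the alternating minors form a left null vector, so a sum of terms of one
  sign is 0; these entries of \<open>y\<close> then vanish, and Cramer's formula contradicts
  \<open>s 0 \<noteq> 0\<close>.\<close>

lemma
  assumes b: "\<And>i. i < m \<Longrightarrow> y i = (\<Sum>q<Suc k. b i q * s q)" and s: "s 0 \<noteq> 0"
    and pos: "\<And>f. index_seq (Suc k) m f \<Longrightarrow> 0 < minor b (Suc k) f (\<lambda>l. l)"
    and pos': "\<And>f. index_seq k m f \<Longrightarrow> 0 < minor b k f Suc"
    and \<delta>: "\<delta> \<in> {-1, 1}"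
  shows weakly_alternating_first_sign:
      "\<lbrakk>index_seq (Suc k) m f; \<And>l. l \<le> k \<Longrightarrow> 0 \<le> \<delta> * (-1) ^ l * y (f l)\<rbrakk> \<Longrightarrow> sgn (s 0) = \<delta>"
    and not_weakly_alternating:
      "\<lbrakk>index_seq (Suc (Suc k)) m f; \<And>l. l \<le> Suc k \<Longrightarrow> 0 \<le> \<delta> * (-1) ^ l * y (f l)\<rbrakk> \<Longrightarrow> False"
proof -
  have cramer: "(\<Sum>i<Suc k. (-1) ^ i * y (f i) * minor b k (f \<circ> insert_index i) Suc) =
     s 0 * minor b (Suc k) f (\<lambda>l. l)" if "index_seq (Suc k) m f" for f
    by (rule cramer_first, rule b) (use that in \<open>auto simp: index_seq_def\<close>)
  {
    assume f: "index_seq (Suc k) m f" and alt: "\<And>l. l \<le> k \<Longrightarrow> 0 \<le> \<delta> * (-1) ^ l * y (f l)"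
    have "0 \<le> (\<Sum>i<Suc k. (\<delta> * (-1) ^ i * y (f i)) * minor b k (f \<circ> insert_index i) Suc)"
      by (intro sum_nonneg mult_nonneg_nonneg alt less_imp_le[OF pos']
          index_seq_comp[OF f index_seq_insert_index]) simp
    also have "\<dots> = \<delta> * (\<Sum>i<Suc k. (-1) ^ i * y (f i) * minor b k (f \<circ> insert_index i) Suc)"
      by (simp only: sum_distrib_left mult.assoc)
    also have "\<dots> = \<delta> * s 0 * minor b (Suc k) f (\<lambda>l. l)" unfolding cramer[OF f] by (simp only: mult.assoc)
    finally have "0 \<le> \<delta> * s 0" using pos[OF f] by (simp only: zero_le_mult_iff) auto
    then show "sgn (s 0) = \<delta>" using \<delta> s by (auto simp: sgn_if)
  next
    assume f: "index_seq (Suc (Suc k)) m f"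
      and alt: "\<And>l. l \<le> Suc k \<Longrightarrow> 0 \<le> \<delta> * (-1) ^ l * y (f l)"
    let ?M = "\<lambda>i. minor b (Suc k) (f \<circ> insert_index i) (\<lambda>l. l)"
    have M: "0 < ?M i" for i
      by (rule pos[OF index_seq_comp[OF f index_seq_insert_index]])
    have "(\<Sum>i<Suc (Suc k). (-1) ^ i * y (f i) * ?M i) =
       (\<Sum>i<Suc (Suc k). \<Sum>q<Suc k. s q * ((-1) ^ i * b (f i) q * ?M i))"
    proof (rule sum.cong[OF refl])
      fix i assume "i \<in> {..<Suc (Suc k)}"
      then have "f i < m" using f by (auto simp: index_seq_def)
      then show "(-1) ^ i * y (f i) * ?M i = (\<Sum>q<Suc k. s q * ((-1) ^ i * b (f i) q * ?M i))"
        by (simp only: b sum_distrib_left sum_distrib_right) (simp only: mult_ac)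
    qed
    also have "\<dots> = (\<Sum>q<Suc k. s q * (\<Sum>i<Suc (Suc k). (-1) ^ i * b (f i) q * ?M i))"
      unfolding sum_distrib_left by (rule sum.swap)
    also have "\<dots> = 0"
    proof (rule sum.neutral, rule ballI)
      fix q assume "q \<in> {..<Suc k}"
      then have "(\<Sum>i<Suc (Suc k). (-1) ^ i * b (f i) q * ?M i) = 0"
        by (intro alternating_minors_left_null) simp
      then show "s q * (\<Sum>i<Suc (Suc k). (-1) ^ i * b (f i) q * ?M i) = 0" by (simp only: mult_zero_right)
    qed
    finally have "\<delta> * (\<Sum>i<Suc (Suc k). (-1) ^ i * y (f i) * ?M i) = 0" by (simp only: mult_zero_right)
    then have sum0: "(\<Sum>i<Suc (Suc k). (\<delta> * (-1) ^ i * y (f i)) * ?M i) = 0"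
      by (simp only: sum_distrib_left mult.assoc)
    have "\<forall>i\<in>{..<Suc (Suc k)}. (\<delta> * (-1) ^ i * y (f i)) * ?M i = 0"
      using sum0 by (subst (asm) sum_nonneg_eq_0_iff) (auto intro!: mult_nonneg_nonneg alt less_imp_le[OF M])
    then have y0: "y (f i) = 0" if "i < Suc (Suc k)" for i
      using that M[of i] \<delta> by auto
    have f': "index_seq (Suc k) m f" by (rule index_seq_mono[OF f]) simp
    have "s 0 * minor b (Suc k) f (\<lambda>l. l) = 0"
      unfolding cramer[OF f', symmetric] by (rule sum.neutral) (auto simp: y0)
    then show False using pos[OF f'] s by simp
  }
qed

text \<open>Stated for an entry function so that it applies to \<open>A\<close> and, with shifted
  indices, to each of its contiguous blocks.\<close>

theorem variation_diminishing:
  assumes pos: "\<And>r f g. index_seq r m f \<Longrightarrow> index_seq r n g \<Longrightarrow> 0 < minor c r f g"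
    and x: "x \<in> carrier_vec n" "x \<noteq> 0\<^sub>v n"
    and y: "y \<in> carrier_vec m" "\<And>i. i < m \<Longrightarrow> y $ i = (\<Sum>j<n. c i j * x $ j)"
  shows "S_plus y \<le> S_minus x"
    and "S_plus y = S_minus x \<Longrightarrow> y \<noteq> 0\<^sub>v m \<Longrightarrow> end_signs_agree y x"
proof -
  define zs where "zs = nonzero_entries x"
  define k where "k = S_minus x"
  define \<epsilon> where "\<epsilon> = sgn (hd zs)"
  have dims: "dim_vec x = n" "dim_vec y = m" using x y by auto
  have zs: "zs \<noteq> []"
  proof
    assume "zs = []"
    then have "x $ i = 0" if "i < n" for i
      using that dims by (auto simp: zs_def nonzero_entries_def filter_empty_conv list_of_vec_map)
    with x dims show False by (auto intro: eq_vecI)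
  qed
  have zs0: "0 \<notin> set zs" by (auto simp: zs_def nonzero_entries_def)
  have \<epsilon>: "\<epsilon> \<in> {-1, 1}" proof -
    have "hd zs \<noteq> 0" using zs0 hd_in_set[OF zs] by metis
    then show ?thesis by (auto simp: \<epsilon>_def sgn_if)
  qed
  obtain \<beta> where \<beta>: "sign_blocks (list_of_vec x) \<epsilon> k \<beta>"
    using sign_blocks_exist[of "list_of_vec x"] zs
    unfolding \<epsilon>_def k_def zs_def nonzero_entries_def S_minus_def by blast
  have \<beta>mono: "\<beta> i \<le> \<beta> j" if "i \<le> j" "j < n" for i j
    using \<beta> that dims by (simp add: sign_blocks_def)
  have \<beta>le: "\<beta> j \<le> k" and xj: "x $ j = \<epsilon> * (-1) ^ \<beta> j * \<bar>x $ j\<bar>" if "j < n" for j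
    using \<beta> that dims unfolding sign_blocks_def length_list_of_vec list_of_vec_index by blast+
  have \<beta>ex: "\<exists>j<n. \<beta> j = l \<and> x $ j \<noteq> 0" if "l \<le> k" for l
    using \<beta> that dims unfolding sign_blocks_def length_list_of_vec list_of_vec_index by blast
  \<comment> \<open>Zero entries of \<open>x\<close> are left out so that all weights
    \<open>\<bar>x $ q\<bar>\<close> are positive.\<close>
  define Q where "Q l = {j. j < n \<and> \<beta> j = l \<and> x $ j \<noteq> 0}" for l
  define b where "b i l = (\<Sum>q\<in>Q l. \<bar>x $ q\<bar> * c i q)" for i l
  have Qord: "p < q" if "l < l'" "p \<in> Q l" "q \<in> Q l'" for l l' p q
    using that \<beta>mono[of q p] by (auto simp: Q_def not_le[symmetric])
  have Qne: "Q l \<noteq> {}" if "l \<le> k" for l using \<beta>ex[OF that] by (auto simp: Q_def)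
  have bpos: "0 < minor b (Suc k) f (\<lambda>l. l)" if "index_seq (Suc k) m f" for f
    unfolding b_def
  proof (rule block_minor_pos[where n = n])
    show "0 < minor c (Suc k) f g" if "index_seq (Suc k) n g" for g
      by (rule pos) fact+
    show "Q l \<noteq> {}" if "l < Suc k" for l using Qne that by simp
    show "p < q" if "l < l'" "p \<in> Q l" "q \<in> Q l'" for l l' p q
      by (rule Qord[OF that])
  qed (auto simp: Q_def)
  have bpos': "0 < minor b k f Suc" if "index_seq k m f" for f
  proof -
    have "0 < minor (\<lambda>i l. \<Sum>q\<in>Q (Suc l). \<bar>x $ q\<bar> * c i q) k f (\<lambda>l. l)"
    proof (rule block_minor_pos[where n = n])
      show "0 < minor c k f g" if "index_seq k n g" for g
        by (rule pos) fact+
      show "Q (Suc l) \<noteq> {}" if "l < k" for l using Qne that by simp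
      show "p < q" if "l < l'" "p \<in> Q (Suc l)" "q \<in> Q (Suc l')" for l l' p q
        by (rule Qord[OF _ that(2,3)]) (use that(1) in simp)
    qed (auto simp: Q_def)
    then show ?thesis by (simp add: minor_def b_def)
  qed
  have yb: "y $ i = (\<Sum>l<Suc k. b i l * (\<epsilon> * (-1) ^ l))" if "i < m" for i
  proof -
    have "y $ i = (\<Sum>j\<in>{j\<in>{..<n}. x $ j \<noteq> 0}. c i j * x $ j)"
      unfolding y(2)[OF that] by (rule sum.mono_neutral_right) auto
    also have "\<dots> = (\<Sum>l\<in>{..<Suc k}. \<Sum>j\<in>{j\<in>{j\<in>{..<n}. x $ j \<noteq> 0}. \<beta> j = l}. c i j * x $ j)"
      by (rule sum.group[symmetric]) (use \<beta>le in \<open>auto simp: less_Suc_eq_le\<close>)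
    also have "\<dots> = (\<Sum>l\<in>{..<Suc k}. b i l * (\<epsilon> * (-1) ^ l))"
    proof (rule sum.cong[OF refl])
      fix l
      have "(\<Sum>j\<in>{j\<in>{j\<in>{..<n}. x $ j \<noteq> 0}. \<beta> j = l}. c i j * x $ j) =
          (\<Sum>j\<in>Q l. \<bar>x $ j\<bar> * c i j * (\<epsilon> * (-1) ^ l))"
      proof (rule sum.cong)
        show "{j\<in>{j\<in>{..<n}. x $ j \<noteq> 0}. \<beta> j = l} = Q l" by (auto simp: Q_def)
        fix j assume "j \<in> Q l"
        then have "x $ j = \<epsilon> * (-1) ^ l * \<bar>x $ j\<bar>" using xj by (auto simp: Q_def)
        then have "c i j * x $ j = c i j * (\<epsilon> * (-1) ^ l * \<bar>x $ j\<bar>)" by (rule arg_cong)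
        then show "c i j * x $ j = \<bar>x $ j\<bar> * c i j * (\<epsilon> * (-1) ^ l)"
          by (simp only: mult_ac)
      qed
      then show "(\<Sum>j\<in>{j\<in>{j\<in>{..<n}. x $ j \<noteq> 0}. \<beta> j = l}. c i j * x $ j) =
          b i l * (\<epsilon> * (-1) ^ l)"
        by (simp only: b_def sum_distrib_right)
    qed
    finally show ?thesis .
  qed
  have s0: "\<epsilon> * (-1) ^ (0::nat) \<noteq> 0" using \<epsilon> by auto
  have first_sign: "sgn (\<epsilon> * (-1) ^ (0::nat)) = \<delta>"
    if "\<delta> \<in> {-1, 1}" "index_seq (Suc k) m f" "\<And>l. l \<le> k \<Longrightarrow> 0 \<le> \<delta> * (-1) ^ l * y $ f l"
    for \<delta> f
    by (rule weakly_alternating_first_sign[where y = "($) y" and b = b and m = m])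
       (fact yb s0 bpos bpos' that)+
  have not_alt: False
    if "\<delta> \<in> {-1, 1}" "index_seq (Suc (Suc k)) m f"
      "\<And>l. l \<le> Suc k \<Longrightarrow> 0 \<le> \<delta> * (-1) ^ l * y $ f l" for \<delta> f
    by (rule not_weakly_alternating[where y = "($) y" and b = b and m = m])
       (fact yb s0 bpos bpos' that)+
  show le: "S_plus y \<le> S_minus x"
  proof (cases "y = 0\<^sub>v m")
    case True
    \<comment> \<open>By convention \<open>S_plus y\<close> is \<open>m\<close> here. If
      \<open>k < m\<close>, the zero vector alternates weakly with either initial sign, and both
      would have to be the sign of \<open>\<epsilon>\<close>.\<close>
    have "m \<le> k"
    proof (rule ccontr)
      assume "\<not> m \<le> k"
      then have seq: "index_seq (Suc k) m ((+) 0)" by (intro index_seq_shift) simp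
      have "sgn (\<epsilon> * (-1) ^ (0::nat)) = \<delta>" if "\<delta> \<in> {-1, 1}" for \<delta>
        by (rule first_sign[OF that seq]) (use \<open>\<not> m \<le> k\<close> True in auto)
      from this[of 1] this[of "-1"] show False by simp
    qed
    then show ?thesis using True by (simp add: S_plus_def k_def)
  next
    case False
    then have m: "0 < m" using y by (cases m) auto
    obtain w where w: "w \<in> zero_assignments y" "sign_changes (list_of_vec w) = S_plus y"
      using S_plus_attained[of y] False dims by metis
    obtain f where f: "index_seq (Suc (S_plus y)) m f"
      "\<And>l. l \<le> S_plus y \<Longrightarrow> 0 \<le> sgn (w $ 0) * (-1) ^ l * y $ f l"
      using S_plus_weakly_alternating[OF y(1) w(1) m] w(2) by metis
    show ?thesis
    proof (rule ccontr)
      assume "\<not> S_plus y \<le> S_minus x"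
      then have gt: "Suc k \<le> S_plus y" by (simp add: k_def)
      have "sgn (w $ 0) \<in> {-1, 1}"
        using zero_assignments_nonzero(2)[OF w(1), of 0] m dims by (auto simp: sgn_if)
      then show False
        by (rule not_alt[OF _ index_seq_mono[OF f(1)] f(2)]) (use gt in auto)
    qed
  qed
  assume eq: "S_plus y = S_minus x" and nz: "y \<noteq> 0\<^sub>v m"
  then have m: "0 < m" using y by (cases m) auto
  have w0: "sgn (w $ 0) = \<epsilon>"
    if w: "w \<in> zero_assignments y" "sign_changes (list_of_vec w) = S_plus y" for w
  proof -
    obtain f where f: "index_seq (Suc k) m f"
      "\<And>l. l \<le> k \<Longrightarrow> 0 \<le> sgn (w $ 0) * (-1) ^ l * y $ f l"
      using S_plus_weakly_alternating[OF y(1) w(1) m] w(2) eq unfolding k_def by metis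
    have "sgn (w $ 0) \<in> {-1, 1}"
      using zero_assignments_nonzero(2)[OF w(1), of 0] m dims by (auto simp: sgn_if)
    from first_sign[OF this f] show ?thesis using \<epsilon> by auto
  qed
  \<comment> \<open>The last sign follows by parity: \<open>w\<close> and \<open>zs\<close> start
    with the same sign and have the same number \<open>k\<close> of changes.\<close>
  have wl: "sgn (w $ (m - 1)) = sgn (last zs)"
    if w: "w \<in> zero_assignments y" "sign_changes (list_of_vec w) = S_plus y" for w
  proof -
    have nzw: "w $ i \<noteq> 0" if "i < m" for i
      using zero_assignments_nonzero(2)[OF w(1)] that dims by simp
    have dw: "dim_vec w = m" using zero_assignments_nonzero(1)[OF w(1)] dims by simp
    have "0 \<notin> set (list_of_vec w)" using nzw dw by (auto simp: list_of_vec_map)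
    moreover have "list_of_vec w \<noteq> []"
      using dw m list_of_vec_eq_Nil_iff[of w] by linarith
    ultimately have "sgn (last (list_of_vec w)) =
        sgn (hd (list_of_vec w)) * (-1) ^ sign_changes (list_of_vec w)"
      by (intro sgn_last_sign_changes)
    then have "sgn (w $ (m - 1)) = \<epsilon> * (-1) ^ k"
      using w0[OF w] dw m w(2) eq by (simp add: last_list_of_vec hd_list_of_vec k_def)
    also have "\<dots> = sgn (last zs)"
      using sgn_last_sign_changes[OF zs zs0] by (simp add: \<epsilon>_def k_def S_minus_def zs_def)
    finally show ?thesis .
  qed
  have "S_plus_sign y 0 = \<epsilon>"
    by (rule S_plus_sign_eqI) (use nz dims m w0 in auto)
  moreover have "S_plus_sign y (m - 1) = sgn (last zs)"
    by (rule S_plus_sign_eqI) (use nz dims m wl in auto)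
  ultimately show "end_signs_agree y x"
    using dims by (simp add: end_signs_agree_def \<epsilon>_def zs_def)
qed

section \<open>Submatrices\<close>

lemma index_seq_pick:
  assumes "finite I" "I \<subseteq> {..<m}"
  shows "index_seq (card I) m (pick I)"
  using assms pick_mono_le pick_in_set_le unfolding index_seq_def by blast

text \<open>\<open>f i\<close> is the element of the image with exactly \<open>i\<close> smaller
  elements.\<close>

lemma pick_image_index_seq:
  assumes f: "index_seq r m f" and i: "i < r"
  shows "pick (f ` {..<r}) i = f i"
proof -
  have less: "f j < f i \<longleftrightarrow> j < i" if "j < r" for j
    using f i that unfolding index_seq_def by (metis less_asym linorder_neqE_nat less_irrefl)
  have "{a \<in> f ` {..<r}. a < f i} = f ` {..<i}"
    using less i by auto
  moreover have "card (f ` {..<i}) = i"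
    using inj_on_subset[OF index_seq_inj_on[OF f], of "{..<i}"] i by (simp add: card_image)
  ultimately show ?thesis using pick_card_in_set[of "f i" "f ` {..<r}"] i by simp
qed

lemma submatrix_index_seq:
  assumes "index_seq r (dim_row A) f" "index_seq r (dim_col A) g"
  shows "submatrix A (f ` {..<r}) (g ` {..<r}) = mat r r (\<lambda>(i,j). A $$ (f i, g j))"
proof -
  have "card {i. i < n \<and> i \<in> h ` {..<r}} = r" if "index_seq r n h" for n h
  proof -
    have "{i. i < n \<and> i \<in> h ` {..<r}} = h ` {..<r}"
      using that by (auto simp: index_seq_def)
    then show ?thesis using index_seq_inj_on[OF that] by (simp add: card_image)
  qed
  then show ?thesis
    using assms by (auto simp: submatrix_def pick_image_index_seq intro!: eq_matI)
qed

lemma totally_positive_iff_minors: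
  "totally_positive A \<longleftrightarrow>
     (\<forall>r f g. index_seq r (dim_row A) f \<longrightarrow> index_seq r (dim_col A) g \<longrightarrow>
        0 < minor (\<lambda>i j. A $$ (i,j)) r f g)" (is "_ \<longleftrightarrow> ?minors")
proof
  assume tp: "totally_positive A"
  show ?minors
  proof (intro allI impI)
    fix r f g
    assume fg: "index_seq r (dim_row A) f" "index_seq r (dim_col A) g"
    show "0 < minor (\<lambda>i j. A $$ (i,j)) r f g"
    \<comment> \<open>\<open>totally_positive\<close> leaves out the empty minor, whose value is
      1.\<close>
    proof (cases "r = 0")
      case False
      have "0 < det (submatrix A (f ` {..<r}) (g ` {..<r}))"
      proof (rule tp[unfolded totally_positive_def, rule_format])
        show "card (f ` {..<r}) = card (g ` {..<r})"
          using fg[THEN index_seq_inj_on] by (simp add: card_image)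
      qed (use fg False in \<open>auto simp: index_seq_def\<close>)
      then show ?thesis by (simp add: submatrix_index_seq[OF fg] minor_def)
    qed simp
  qed
next
  assume minors: ?minors
  show "totally_positive A"
    unfolding totally_positive_def
  proof (intro allI impI)
    fix I J assume IJ: "I \<subseteq> {..<dim_row A}" "J \<subseteq> {..<dim_col A}" "I \<noteq> {}" "card I = card J"
    then have fin: "finite I" "finite J" using finite_subset by blast+
    have "{i. i < dim_row A \<and> i \<in> I} = I" "{j. j < dim_col A \<and> j \<in> J} = J" using IJ by auto
    then have "det (submatrix A I J) = minor (\<lambda>i j. A $$ (i,j)) (card I) (pick I) (pick J)"
      using IJ by (simp add: submatrix_def minor_def)
    also have "0 < \<dots>"
      using minors index_seq_pick[OF fin(1) IJ(1)] index_seq_pick[OF fin(2) IJ(2)] IJ(4) by simp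
    finally show "0 < det (submatrix A I J)" .
  qed
qed

section \<open>Contiguous blocks and their test vectors\<close>

definition block :: "real mat \<Rightarrow> nat \<Rightarrow> nat \<Rightarrow> nat \<Rightarrow> real mat" where
  "block A i j r = mat r r (\<lambda>(p,q). A $$ (i + p, j + q))"

lemma block_carrier [simp]: "block A i j r \<in> carrier_mat r r"
  by (simp add: block_def)

lemma dim_block [simp]: "dim_row (block A i j r) = r" "dim_col (block A i j r) = r"
  by (simp_all add: block_def)

lemma contiguous_submatrix_iff:
  "contiguous_submatrix r A B \<longleftrightarrow>
     (\<exists>i j. i + r \<le> dim_row A \<and> j + r \<le> dim_col A \<and> B = block A i j r)"
proof -
  have "(+) i ` {..<r} = {i..<i + r}" for i :: nat
    by (simp add: image_add_atLeastLessThan lessThan_atLeast0 add.commute)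
  then have "submatrix A {i..<i + r} {j..<j + r} = block A i j r"
    if "i + r \<le> dim_row A" "j + r \<le> dim_col A" for i j
    using submatrix_index_seq[OF index_seq_shift[OF that(1)] index_seq_shift[OF that(2)]]
    by (simp add: block_def)
  then show ?thesis unfolding contiguous_submatrix_def by metis
qed

lemma det_block: "det (block A i j r) = minor (\<lambda>i j. A $$ (i,j)) r ((+) i) ((+) j)"
  by (simp add: block_def minor_def)

lemma dim_test_vec [simp]: "dim_vec (test_vec B) = dim_col B"
  by (simp add: test_vec_def)

lemma test_vec_carrier [simp]: "test_vec (block A i j r) \<in> carrier_vec r"
  by (simp add: test_vec_def)

text \<open>Deleting row 0 and column 0 leaves a contiguous block with its corner one step down the
  diagonal; this is what lets an induction on the order run over contiguous minors alone.\<close>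

lemma test_vec_block_0:
  "test_vec (block A i j (Suc d)) $ 0 = minor (\<lambda>i j. A $$ (i,j)) d ((+) (Suc i)) ((+) (Suc j))"
proof -
  have "mat_delete (block A i j (Suc d)) 0 0 = mat d d (\<lambda>(p,q). A $$ (Suc i + p, Suc j + q))"
    by (auto simp: mat_delete_def block_def intro!: eq_matI)
  then show ?thesis by (simp add: test_vec_def minor_def)
qed

text \<open>The test vector is the first column of the adjugate: row 0 of \<open>B\<close> gives the
  expansion of \<open>det B\<close>, any other row the expansion of a determinant with two equal
  rows.\<close>

lemma mult_test_vec:
  assumes B: "B \<in> carrier_mat (Suc d) (Suc d)"
  shows "B *\<^sub>v test_vec B = vec (Suc d) (\<lambda>p. if p = 0 then det B else 0)"
proof (rule eq_vecI)
  define c where "c = (\<lambda>i j. B $$ (i,j))"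
  have dim: "dim_row B = Suc d" "dim_col B = Suc d" using B by auto
  have Bc: "B = mat (Suc d) (Suc d) (\<lambda>(i,j). c i j)" by (rule eq_matI) (auto simp: dim c_def)
  \<comment> \<open>The array is transposed because \<open>minor_laplace\<close> expands along a
    column.\<close>
  have del: "det (mat_delete B 0 q) = minor (\<lambda>i j. c j i) d (insert_index q) Suc" if "q < Suc d" for q
  proof -
    have "mat_delete B 0 q = mat d d (\<lambda>(i,j). c (Suc i) (insert_index q j))"
      using that by (auto simp: mat_delete_def dim c_def insert_index_def intro!: eq_matI)
    then show ?thesis by (subst minor_swap) (simp add: minor_def)
  qed
  fix p assume "p < dim_vec (vec (Suc d) (\<lambda>p. if p = 0 then det B else 0))"
  then have p: "p < Suc d" by simp
  have "(B *\<^sub>v test_vec B) $ p =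
      (\<Sum>q<Suc d. (-1) ^ q * c p q * minor (\<lambda>i j. c j i) d (insert_index q) Suc)"
    using p dim by (auto simp: scalar_prod_def test_vec_def del c_def atLeast0LessThan intro!: sum.cong)
  also have "\<dots> = (if p = 0 then det B else 0)"
  proof (cases p)
    case 0
    have "det B = minor (\<lambda>i j. c j i) (Suc d) (\<lambda>i. i) (\<lambda>i. i)"
      by (subst minor_swap, subst Bc) (simp add: minor_def)
    then show ?thesis
      using minor_laplace[of "\<lambda>i j. c j i" d "\<lambda>i. i" "\<lambda>i. i"] 0 by (simp add: comp_def)
  next
    case (Suc p')
    then show ?thesis
      using alternating_minors_left_null[of p' d "\<lambda>i j. c j i" "\<lambda>i. i" Suc] p
      by (simp add: comp_def)
  qed
  finally show "(B *\<^sub>v test_vec B) $ p = vec (Suc d) (\<lambda>p. if p = 0 then det B else 0) $ p"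
    using p by simp
qed (use B in auto)

lemma list_of_vec_Suc:
  "v \<in> carrier_vec (Suc d) \<Longrightarrow> list_of_vec v = v $ 0 # map (\<lambda>q. v $ Suc q) [0..<d]"
  by (simp only: list_of_vec_map carrier_vecD upt_rec[of 0 "Suc d"] map_Suc_upt[symmetric])
     (simp add: comp_def)

definition pad_vec :: "nat \<Rightarrow> nat \<Rightarrow> real vec \<Rightarrow> real vec" where
  "pad_vec n j t = vec n (\<lambda>q. if j \<le> q \<and> q < j + dim_vec t then t $ (q - j) else 0)"

lemma nonzero_entries_pad_vec:
  assumes "j + dim_vec t \<le> n"
  shows "nonzero_entries (pad_vec n j t) = nonzero_entries t"
proof -
  let ?r = "dim_vec t"
  let ?p = "\<lambda>q. if j \<le> q \<and> q < j + ?r then t $ (q - j) else 0"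
  have "[0..<n] = [0..<j] @ [j..<j + ?r] @ [j + ?r..<n]"
    using assms upt_add_eq_append[of 0 j "n - j"] upt_add_eq_append[of j "j + ?r" "n - (j + ?r)"]
    by simp
  moreover have "map ?p [j..<j + ?r] = list_of_vec t"
    by (rule nth_equalityI) (auto simp: list_of_vec_index)
  moreover have "filter (\<lambda>a. a \<noteq> 0) (map ?p [0..<j]) = []" "filter (\<lambda>a. a \<noteq> 0) (map ?p [j + ?r..<n]) = []"
    by (auto simp: filter_empty_conv)
  ultimately show ?thesis
    by (simp only: nonzero_entries_def pad_vec_def list_of_vec_vec map_append filter_append
        append_Nil append_Nil2)
qed

lemma mult_pad_vec:
  assumes A: "A \<in> carrier_mat m n" and i: "i + r \<le> m" and j: "j + r \<le> n" and l: "l < r"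
    and t: "t \<in> carrier_vec r"
  shows "(A *\<^sub>v pad_vec n j t) $ (i + l) = (block A i j r *\<^sub>v t) $ l"
proof -
  have tr: "dim_vec t = r" using t by auto
  have "(A *\<^sub>v pad_vec n j t) $ (i + l) = (\<Sum>q<n. A $$ (i + l, q) * pad_vec n j t $ q)"
    using A i l by (auto simp: scalar_prod_def pad_vec_def atLeast0LessThan intro!: sum.cong)
  also have "\<dots> = (\<Sum>q\<in>{j..<j + r}. A $$ (i + l, q) * pad_vec n j t $ q)"
    by (rule sum.mono_neutral_right) (use j tr in \<open>auto simp: pad_vec_def\<close>)
  also have "\<dots> = (\<Sum>q<r. A $$ (i + l, j + q) * t $ q)"
    by (rule sum.reindex_bij_witness[of _ "\<lambda>q. j + q" "\<lambda>q. q - j"])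
       (use j tr in \<open>auto simp: pad_vec_def\<close>)
  also have "\<dots> = (block A i j r *\<^sub>v t) $ l"
    using l tr by (auto simp: scalar_prod_def block_def atLeast0LessThan intro!: sum.cong)
  finally show ?thesis .
qed

section \<open>Equivalence of total positivity with the two sign conditions\<close>

theorem theorem4:
  fixes A :: "real mat" and m n :: nat
  assumes "A \<in> carrier_mat m n"
  defines "cond_i \<equiv> totally_positive A"
    and "cond_ii \<equiv>
      (\<forall>x \<in> carrier_vec n. x \<noteq> 0\<^sub>v n \<longrightarrow>
         S_plus (A *\<^sub>v x) \<le> S_minus x \<and>
         (S_plus (A *\<^sub>v x) = S_minus x \<and> A *\<^sub>v x \<noteq> 0\<^sub>v m \<longrightarrow> end_signs_agree (A *\<^sub>v x) x))"
    and "cond_iii \<equiv>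
      (\<forall>r \<in> {1..min m n}. \<forall>B. contiguous_submatrix r A B \<longrightarrow>
         S_plus (B *\<^sub>v test_vec B) \<le> S_minus (test_vec B) \<and>
         (S_plus (B *\<^sub>v test_vec B) = S_minus (test_vec B) \<longrightarrow>
            end_signs_agree (B *\<^sub>v test_vec B) (test_vec B)))"
  shows "(cond_i \<longleftrightarrow> cond_ii) \<and> (cond_i \<longleftrightarrow> cond_iii)"
proof -
  define c where "c = (\<lambda>i j. A $$ (i,j))"
  have dim: "dim_row A = m" "dim_col A = n" using assms(1) by auto
  have tp: "cond_i \<longleftrightarrow>
      (\<forall>r f g. index_seq r m f \<longrightarrow> index_seq r n g \<longrightarrow> 0 < minor c r f g)"
    unfolding cond_i_def totally_positive_iff_minors dim c_def ..
  have nonzero: "t \<noteq> 0\<^sub>v d" if "t $ 0 > 0" "t \<in> carrier_vec d" "0 < d" for t :: "real vec" and d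
    using that by auto
  have i_ii: cond_ii if cond_i
    unfolding cond_ii_def
  proof (intro ballI impI conjI)
    fix x :: "real vec" assume x: "x \<in> carrier_vec n" "x \<noteq> 0\<^sub>v n"
    have Ax: "A *\<^sub>v x \<in> carrier_vec m" using assms(1) x by simp
    have entry: "(A *\<^sub>v x) $ i = (\<Sum>j<n. c i j * x $ j)" if "i < m" for i
      using that dim x by (auto simp: scalar_prod_def c_def atLeast0LessThan intro!: sum.cong)
    have pos: "0 < minor c r f g" if "index_seq r m f" "index_seq r n g" for r f g
      using \<open>cond_i\<close> that unfolding tp by blast
    show "S_plus (A *\<^sub>v x) \<le> S_minus x"
      by (rule variation_diminishing(1)[OF pos x Ax entry])
    assume "S_plus (A *\<^sub>v x) = S_minus x \<and> A *\<^sub>v x \<noteq> 0\<^sub>v m"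
    then show "end_signs_agree (A *\<^sub>v x) x"
      by (intro variation_diminishing(2)[OF pos x Ax entry]) simp_all
  qed
  have i_iii: cond_iii if cond_i
    unfolding cond_iii_def
  proof (intro ballI allI impI conjI)
    fix r B assume r: "r \<in> {1..min m n}" and "contiguous_submatrix r A B"
    then obtain i j where ij: "i + r \<le> m" "j + r \<le> n" and B: "B = block A i j r"
      unfolding contiguous_submatrix_iff dim by blast
    obtain d where d: "r = Suc d" using r by (cases r) auto
    have pos: "0 < minor c s f g" if "index_seq s m f" "index_seq s n g" for s f g
      using \<open>cond_i\<close> that unfolding tp by blast
    have posB: "0 < minor (\<lambda>p q. c (i + p) (j + q)) s f g"
      if "index_seq s r f" "index_seq s r g" for s f g
      using pos[OF index_seq_comp[OF index_seq_shift[OF ij(1)] that(1)]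
          index_seq_comp[OF index_seq_shift[OF ij(2)] that(2)]]
      by (simp add: minor_def)
    have x: "test_vec B \<in> carrier_vec r" by (simp add: B)
    \<comment> \<open>This entry is a contiguous minor of order \<open>d\<close>, equal to 1 if
      \<open>d = 0\<close>.\<close>
    have "0 < test_vec B $ 0"
      using pos[OF index_seq_shift[of "Suc i" d m] index_seq_shift[of "Suc j" d n]] ij
      by (simp add: B d test_vec_block_0 c_def)
    from nonzero[OF this x] have x0: "test_vec B \<noteq> 0\<^sub>v r" using d by simp
    have Bx: "B *\<^sub>v test_vec B \<in> carrier_vec r"
      by (rule mult_mat_vec_carrier[OF _ x]) (simp add: B)
    have entry: "(B *\<^sub>v test_vec B) $ p = (\<Sum>q<r. c (i + p) (j + q) * test_vec B $ q)" if "p < r" for p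
      using that x unfolding B
      by (auto simp: scalar_prod_def c_def block_def atLeast0LessThan intro!: sum.cong)
    show "S_plus (B *\<^sub>v test_vec B) \<le> S_minus (test_vec B)"
      by (rule variation_diminishing(1)[OF posB x x0 Bx entry])
    assume eq: "S_plus (B *\<^sub>v test_vec B) = S_minus (test_vec B)"
    \<comment> \<open>Condition (iii) makes no exception for a zero image, so that case is ruled out
      by the positive first entry \<open>det B\<close>.\<close>
    have "(B *\<^sub>v test_vec B) $ 0 = det B"
      using mult_test_vec[of B d] by (simp add: B d)
    also have "0 < det B"
      using pos[OF index_seq_shift[OF ij(1)] index_seq_shift[OF ij(2)]]
      by (simp add: B det_block c_def)
    finally have "B *\<^sub>v test_vec B \<noteq> 0\<^sub>v r" using nonzero[OF _ Bx] d by simp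
    then show "end_signs_agree (B *\<^sub>v test_vec B) (test_vec B)"
      by (intro variation_diminishing(2)[OF posB x x0 Bx entry eq]) assumption+
  qed
  \<comment> \<open>One induction on the order serves both hypotheses: the induction hypothesis
    makes the first entry of the test vector positive, and \<open>peak_pos\<close> passes its sign
    to the determinant.\<close>
  have contig: "0 < minor c r ((+) i) ((+) j)"
    if "cond_ii \<or> cond_iii" "i + r \<le> m" "j + r \<le> n" for r i j
    using that(2,3)
  proof (induction r arbitrary: i j)
    case (Suc d)
    let ?B = "block A i j (Suc d)"
    let ?t = "test_vec ?B"
    have "0 < minor c d ((+) (Suc i)) ((+) (Suc j))"
      by (rule Suc.IH) (use Suc.prems in simp_all)
    then have t0: "0 < ?t $ 0" by (simp only: test_vec_block_0 c_def)
    have t: "list_of_vec ?t = ?t $ 0 # map (\<lambda>q. ?t $ Suc q) [0..<d]"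
      by (rule list_of_vec_Suc) simp
    have Bt: "?B *\<^sub>v ?t = vec (Suc d) (\<lambda>p. if p = 0 then det ?B else 0)"
      by (rule mult_test_vec) simp
    from that(1) have "0 < det ?B"
    proof
      assume ii: cond_ii
      \<comment> \<open>Padding keeps the nonzero entries, and rows \<open>i\<close> to
        \<open>i + d\<close> of \<open>A *\<^sub>v x\<close> become the image of the test vector
        under the block.\<close>
      define x where "x = pad_vec n j ?t"
      have x: "x \<in> carrier_vec n" by (simp add: x_def pad_vec_def)
      have nx: "nonzero_entries x = nonzero_entries ?t"
        unfolding x_def by (rule nonzero_entries_pad_vec) (use Suc.prems in simp)
      have "x $ j = ?t $ 0" using Suc.prems by (simp add: x_def pad_vec_def)
      with t0 Suc.prems have "x \<noteq> 0\<^sub>v n" by auto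
      with ii x have *: "S_plus (A *\<^sub>v x) \<le> S_minus x"
        "S_plus (A *\<^sub>v x) = S_minus x \<Longrightarrow> A *\<^sub>v x \<noteq> 0\<^sub>v m \<Longrightarrow> end_signs_agree (A *\<^sub>v x) x"
        unfolding cond_ii_def by blast+
      have v: "(A *\<^sub>v x) $ (i + l) = (?B *\<^sub>v ?t) $ l" if "l < Suc d" for l
        unfolding x_def by (rule mult_pad_vec[OF assms(1) Suc.prems that]) simp
      have "0 < (A *\<^sub>v x) $ i"
      proof (rule peak_pos[where m = m and d = d and i = i])
        show "A *\<^sub>v x \<in> carrier_vec m" using assms(1) x by simp
        show "(A *\<^sub>v x) $ (i + l) = 0" if "0 < l" "l \<le> d" for l
          using v[of l] that Bt by simp
        show "nonzero_entries x = filter (\<lambda>a. a \<noteq> 0) (?t $ 0 # map (\<lambda>q. ?t $ Suc q) [0..<d])"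
          using nx unfolding nonzero_entries_def t .
      qed (use t0 Suc.prems * in simp_all)
      then show ?thesis using v[of 0] Bt by simp
    next
      assume iii: cond_iii
      have "contiguous_submatrix (Suc d) A ?B"
        unfolding contiguous_submatrix_iff dim using Suc.prems by blast
      moreover have "Suc d \<in> {1..min m n}" using Suc.prems by simp
      ultimately have *: "S_plus (?B *\<^sub>v ?t) \<le> S_minus ?t"
        "S_plus (?B *\<^sub>v ?t) = S_minus ?t \<Longrightarrow> end_signs_agree (?B *\<^sub>v ?t) ?t"
        using iii unfolding cond_iii_def by blast+
      have "0 < (?B *\<^sub>v ?t) $ 0"
      proof (rule peak_pos[where m = "Suc d" and d = d and i = 0 and x = "?t"])
        show "?B *\<^sub>v ?t \<in> carrier_vec (Suc d)" by (simp add: Bt)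
        show "(?B *\<^sub>v ?t) $ (0 + l) = 0" if "0 < l" "l \<le> d" for l
          using that Bt by simp
        show "nonzero_entries ?t = filter (\<lambda>a. a \<noteq> 0) (?t $ 0 # map (\<lambda>q. ?t $ Suc q) [0..<d])"
          unfolding nonzero_entries_def t ..
      qed (use t0 * in simp_all)
      then show ?thesis using Bt by simp
    qed
    then show ?case by (simp add: det_block c_def)
  qed simp
  have "cond_i" if "cond_ii \<or> cond_iii"
    unfolding tp using minors_pos_if_contiguous_pos[of m n c, OF contig[OF that]] by blast
  with i_ii i_iii show ?thesis by blast
qed

end
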